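(* Let $k \geq 2$ be an integer and let $\delta > 0$. There exists $s = s(k,\delta) \in \mathbb{N}$, depending only on $k$ and $\delta$, such that for every $A \subseteq \mathbb{N}^{(k)}$ which is not a subset of any non-trivial arithmetic progression and satisfies $\underline{\delta}(A) > \delta$, all sufficiently large natural numbers belong to $sA$.
   Context: $\mathbb{N}$ is the set of positive integers and $[N]=\{1,\dots,N\}$. $\mathbb{N}^{(k)}=\{t^k : t\in\mathbb{N}\}$. For $A\subseteq\mathbb{N}^{(k)}$, $\underline{\delta}(A)=\liminf_{N\to\infty}\frac{|A\cap[N]|}{|\mathbb{N}^{(k)}\cap[N]|}$. An arithmetic progression is a residue class $\{n : n\equiv a \pmod d\}$; it is non-trivial if its modulus $d\geq 1$ is not equal to $1$. $sA=\{a_1+\dots+a_s : a_1,\dots,a_s\in A\}$. How large is "sufficiently large" may depend on $A$. *)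

theory Defs
  imports Complex_Main "HOL-Library.Extended_Real" "HOL-Number_Theory.Cong"
begin

definition kth_powers :: "nat \<Rightarrow> nat set" where
  "kth_powers k = {t ^ k | t. t \<ge> 1}"

(* The term for N = 0 is 0 / 0 = 0 by convention; it does not affect the limes inferior. *)
definition lower_rel_density :: "nat \<Rightarrow> nat set \<Rightarrow> ereal" where
  "lower_rel_density k A =
     liminf (\<lambda>N. ereal (real (card (A \<inter> {1..N})) / real (card (kth_powers k \<inter> {1..N}))))"

definition arith_prog :: "nat \<Rightarrow> nat \<Rightarrow> nat set" where
  "arith_prog a d = {n. [n = a] (mod d)}"

definition nontrivial_arith_prog :: "nat set \<Rightarrow> bool" where
  "nontrivial_arith_prog P \<longleftrightarrow> (\<exists>a d. d \<ge> 1 \<and> d \<noteq> 1 \<and> P = arith_prog a d)"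

definition sumset :: "nat \<Rightarrow> nat set \<Rightarrow> nat set" where
  "sumset s A = {\<Sum>i<s. a i | a. \<forall>i<s. a i \<in> A}"

end

theory Submission
  imports Defs "HOL-Analysis.Kronecker_Approximation_Theorem" "HOL-Library.FuncSet"
begin

text \<open>
  The theorem is Waring's problem for a dense set \<open>A\<close> of \<open>k\<close>-th powers, and it splits into an
  analytic half, which passes from \<open>A\<close> to a set of positive density, and a combinatorial half,
  which passes from positive density to all large integers. Both halves lose only constants that
  depend on \<open>k\<close> and \<open>\<delta>\<close>.

  Analytic half. For a suitable \<open>s\<close> depending on \<open>k\<close>, no integer is a sum of \<open>s\<close> \<open>k\<close>-th powers of
  numbers up to \<open>X\<close> in more than \<open>K X\<^sup>s / X\<^sup>k\<close> ways. Once this is known, the roughly \<open>(\<delta> X)\<^sup>s\<close> tuples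
  from \<open>A\<close> must produce a positive proportion of the integers up to \<open>s X\<^sup>k\<close>
  (\<open>sumset_powers_density\<close>). Counting modulo \<open>M = X\<^sup>k\<close> bounds the number of representations by an
  average of \<open>s\<close>-th powers of absolute values of Weyl sums at the points \<open>a / M\<close>
  (\<open>representations_le_moment\<close>). The average is estimated through level sets: by an inverse form of
  Weyl's inequality without any logarithmic loss (\<open>weyl_inverse\<close>), a Weyl sum of size \<open>X / Q\<close> forces
  \<open>a / M\<close> to lie within \<open>Q\<^sup>C / X\<^sup>k\<close> of a fraction whose denominator is polynomial in \<open>Q\<close>. So at most
  polynomially many \<open>a\<close> reach that size, and a large moment converges (\<open>weyl_sum_moment\<close>). The inverse inequality is proved by induction on the degree:
  differencing lowers the degree, and \<open>vinogradov_lemma\<close> recovers \<open>\<beta>\<close> from the information that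
  \<open>\<beta> h\<close> is close to an integer for many \<open>h\<close>.

  Combinatorial half. Let \<open>B\<close> have lower density at least \<open>\<beta>\<close> and lie in no residue class to a
  modulus above \<open>1\<close>. Seen from a well-chosen origin, \<open>B\<close> has positive Schnirelmann density
  (\<open>schnirelmann_origin\<close>), so Schnirelmann's theorem represents every integer, provided that the origin
  itself may be used as a summand. Replacing the origin by its successor, which belongs to \<open>B\<close>, costs
  an error of at most the number \<open>j\<close> of summands; hence \<open>j B\<close> has gaps of length at most \<open>j + 1\<close>.
  For a set with gaps bounded by \<open>g\<close>, the least number of elements that the sumsets have in distant
  windows of length \<open>2 g\<close> grows with every further summand until the windows are full: a window that
  gained nothing would be invariant under differences without common divisor
  (\<open>sumset_syndetic_cofinite\<close>). This takes at most \<open>2 g\<close> steps, so the number of summands is controlled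
  by the density alone.
\<close>

section \<open>Iterated sumsets\<close>

lemma sumset_0: "sumset 0 A = {0}"
  by (auto simp: sumset_def)

lemma sumset_Suc: "sumset (Suc s) A = {x + y | x y. x \<in> sumset s A \<and> y \<in> A}"
proof (intro set_eqI iffI)
  fix z assume "z \<in> sumset (Suc s) A"
  then obtain a where a: "z = (\<Sum>i<Suc s. a i)" "\<forall>i<Suc s. a i \<in> A"
    by (auto simp: sumset_def)
  then have "(\<Sum>i<s. a i) \<in> sumset s A" by (auto simp: sumset_def)
  then show "z \<in> {x + y | x y. x \<in> sumset s A \<and> y \<in> A}" using a by auto
next
  fix z assume "z \<in> {x + y | x y. x \<in> sumset s A \<and> y \<in> A}"
  then obtain a y where a: "\<forall>i<s. a i \<in> A" "y \<in> A" "z = (\<Sum>i<s. a i) + y"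
    by (auto simp: sumset_def)
  have "(\<Sum>i<Suc s. (a(s := y)) i) = z" by (simp add: a)
  moreover have "\<forall>i<Suc s. (a(s := y)) i \<in> A" using a by (auto simp: less_Suc_eq)
  ultimately show "z \<in> sumset (Suc s) A" unfolding sumset_def by blast
qed

lemma sumset_1: "sumset (Suc 0) A = A"
  by (simp add: sumset_Suc sumset_0)

lemma sumset_add: "x \<in> sumset s A \<Longrightarrow> y \<in> sumset t A \<Longrightarrow> x + y \<in> sumset (s + t) A"
proof (induction t arbitrary: y)
  case (Suc t)
  then obtain u v where "y = u + v" "u \<in> sumset t A" "v \<in> A" by (auto simp: sumset_Suc)
  with Suc show ?case by (auto simp: sumset_Suc) (metis add.assoc)
qed (simp add: sumset_0)

lemma sumset_mult: "x \<in> sumset t (sumset s A) \<Longrightarrow> x \<in> sumset (t * s) A"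
proof (induction t arbitrary: x)
  case (Suc t)
  then obtain u v where "x = u + v" "u \<in> sumset t (sumset s A)" "v \<in> sumset s A"
    by (auto simp: sumset_Suc)
  with Suc.IH sumset_add[of u "t * s" A v s] show ?case by (simp add: add.commute)
qed (simp add: sumset_0)

lemma sumset_nonempty: "A \<noteq> {} \<Longrightarrow> sumset s A \<noteq> {}"
  by (induction s) (auto simp: sumset_0 sumset_Suc)

text \<open>Unlike the negated existential over progressions, this form speaks of pairs of elements and
  is visibly inherited by sumsets.\<close>

definition unconfined :: "nat set \<Rightarrow> bool" where
  "unconfined A \<longleftrightarrow> (\<forall>d\<ge>2. \<exists>x\<in>A. \<exists>y\<in>A. \<not> [x = y] (mod d))"

lemma unconfined_iff: "unconfined A \<longleftrightarrow> \<not> (\<exists>P. nontrivial_arith_prog P \<and> A \<subseteq> P)"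
proof
  assume u: "unconfined A"
  show "\<not> (\<exists>P. nontrivial_arith_prog P \<and> A \<subseteq> P)"
  proof
    assume "\<exists>P. nontrivial_arith_prog P \<and> A \<subseteq> P"
    then obtain a d where d: "d \<ge> 1" "d \<noteq> 1" "A \<subseteq> arith_prog a d"
      by (auto simp: nontrivial_arith_prog_def)
    then obtain x y where "x \<in> A" "y \<in> A" "\<not> [x = y] (mod d)"
      using u unfolding unconfined_def by (metis One_nat_def Suc_1 Suc_leI le_neq_implies_less)
    moreover from this d(3) have "[x = a] (mod d)" "[y = a] (mod d)"
      unfolding arith_prog_def by blast+
    ultimately show False by (meson cong_sym cong_trans)
  qed
next
  assume n: "\<not> (\<exists>P. nontrivial_arith_prog P \<and> A \<subseteq> P)"
  show "unconfined A" unfolding unconfined_def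
  proof (intro allI impI)
    fix d :: nat assume d: "2 \<le> d"
    then have ap: "nontrivial_arith_prog (arith_prog a d)" for a
      unfolding nontrivial_arith_prog_def by (intro exI[of _ a] exI[of _ d]) auto
    with n have "A \<noteq> {}" by blast
    then obtain x where x: "x \<in> A" by blast
    have "\<not> A \<subseteq> arith_prog x d" using n ap by blast
    then show "\<exists>x\<in>A. \<exists>y\<in>A. \<not> [x = y] (mod d)"
      using x unfolding arith_prog_def by blast
  qed
qed

lemma unconfined_nonempty: "unconfined A \<Longrightarrow> A \<noteq> {}"
  unfolding unconfined_def by blast

lemma unconfined_sumset:
  assumes "unconfined A" and "s \<ge> 1"
  shows "unconfined (sumset s A)"
  unfolding unconfined_def
proof (intro allI impI)
  fix d :: nat assume "2 \<le> d"
  then obtain x y where xy: "x \<in> A" "y \<in> A" "\<not> [x = y] (mod d)"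
    using assms unfolding unconfined_def by blast
  obtain r where r: "s = Suc r" using assms(2) by (cases s) auto
  obtain u where "u \<in> sumset r A" using sumset_nonempty[of A r] xy by blast
  then have "u + x \<in> sumset s A" "u + y \<in> sumset s A" using xy r by (auto simp: sumset_Suc)
  moreover have "\<not> [u + x = u + y] (mod d)" using xy(3) by (simp add: cong_add_lcancel_nat)
  ultimately show "\<exists>x\<in>sumset s A. \<exists>y\<in>sumset s A. \<not> [x = y] (mod d)" by blast
qed

section \<open>Sets with bounded gaps\<close>

definition window_period :: "nat set \<Rightarrow> nat \<Rightarrow> nat \<Rightarrow> nat \<Rightarrow> bool" where
  "window_period S n L h \<longleftrightarrow> (\<forall>w. n \<le> w \<and> w + h < n + L \<longrightarrow> (w \<in> S \<longleftrightarrow> w + h \<in> S))"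

text \<open>One step of the subtractive Euclidean algorithm on periods. Since \<open>h1 + h2 \<le> L\<close>, every point of
  the window can be moved either up by \<open>h1\<close> or down by \<open>h2\<close> without leaving it.\<close>

lemma window_period_diff:
  assumes "window_period S n L h1" "window_period S n L h2" "h2 \<le> h1" "h1 + h2 \<le> L"
  shows "window_period S n L (h1 - h2)"
  unfolding window_period_def
proof (intro allI impI)
  fix w assume w: "n \<le> w \<and> w + (h1 - h2) < n + L"
  show "w \<in> S \<longleftrightarrow> w + (h1 - h2) \<in> S"
  proof (cases "w + h1 < n + L")
    case True
    have "w \<in> S \<longleftrightarrow> w + h1 \<in> S" using assms(1) w True unfolding window_period_def by blast
    moreover have "w + (h1 - h2) \<in> S \<longleftrightarrow> w + (h1 - h2) + h2 \<in> S"
      using assms(2,3) w True unfolding window_period_def by auto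
    ultimately show ?thesis using assms(3) by simp
  next
    case False
    then have ge: "n + h2 \<le> w" using assms(4) by linarith
    define v where "v = w - h2"
    have v: "w = v + h2" "n \<le> v" using ge unfolding v_def by auto
    have "v \<in> S \<longleftrightarrow> v + h2 \<in> S"
      using assms(2) w v unfolding window_period_def by (metis add_lessD1)
    moreover have "v \<in> S \<longleftrightarrow> v + h1 \<in> S"
      using assms(1,3) w v unfolding window_period_def by auto
    ultimately show ?thesis using v assms(3) by simp
  qed
qed

text \<open>The least period divides all periods up to \<open>g\<close>, hence it is \<open>1\<close>. The window has length \<open>2 g\<close>
  so that any two such periods can be subtracted.\<close>

lemma window_full:
  assumes ne: "S \<inter> {n..<n + 2 * g} \<noteq> {}"
    and H: "\<And>h. h \<in> H \<Longrightarrow> 1 \<le> h \<and> h \<le> g \<and> window_period S n (2 * g) h"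
    and gcd: "\<And>e. e \<ge> 2 \<Longrightarrow> \<exists>h\<in>H. \<not> e dvd h"
  shows "{n..<n + 2 * g} \<subseteq> S"
proof -
  define Q where "Q h \<longleftrightarrow> 1 \<le> h \<and> h \<le> g \<and> window_period S n (2 * g) h" for h
  obtain h0 where "h0 \<in> H" using gcd[of 2] by auto
  then have "Q h0" using H unfolding Q_def by blast
  define p where "p = (LEAST h. Q h)"
  have Qp: "Q p" unfolding p_def by (rule LeastI, fact)
  have dvd: "p dvd h" if "Q h" for h
    using that
  proof (induction h rule: less_induct)
    case (less h)
    have le: "p \<le> h" unfolding p_def by (rule Least_le, fact)
    show ?case
    proof (cases "h = p")
      case False
      with le have "Q (h - p)" using less.prems Qp unfolding Q_def
        by (auto intro!: window_period_diff)
      moreover have "h - p < h" using Qp le unfolding Q_def by auto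
      ultimately have "p dvd h - p" using less.IH by blast
      then show ?thesis using le by (simp add: dvd_diff_nat dvd_minus_self)
    qed simp
  qed
  have "p = 1"
  proof (rule ccontr)
    assume "p \<noteq> 1"
    then have "p \<ge> 2" using Qp unfolding Q_def by auto
    then obtain h where "h \<in> H" "\<not> p dvd h" using gcd by blast
    then show False using dvd H unfolding Q_def by blast
  qed
  then have per: "window_period S n (2 * g) 1" using Qp unfolding Q_def by simp
  have eq: "n + i \<in> S \<longleftrightarrow> n \<in> S" if "i < 2 * g" for i
    using that
  proof (induction i)
    case (Suc i)
    have "n + i \<in> S \<longleftrightarrow> n + i + 1 \<in> S"
      using per Suc.prems unfolding window_period_def by auto
    with Suc show ?case by simp
  qed simp
  obtain w where w: "w \<in> S" "n \<le> w" "w < n + 2 * g" using ne by auto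
  then have "n \<in> S" using eq[of "w - n"] by auto
  show ?thesis
  proof
    fix x assume "x \<in> {n..<n + 2 * g}"
    then show "x \<in> S" using eq[of "x - n"] \<open>n \<in> S\<close> by auto
  qed
qed

lemma syndetic_congruent:
  fixes D :: "nat set"
  assumes gap: "\<And>n. n \<ge> N0 \<Longrightarrow> D \<inter> {n..<n + g} \<noteq> {}"
    and dv: "\<And>x y. x \<in> D \<Longrightarrow> y \<in> D \<Longrightarrow> x < y \<Longrightarrow> y \<le> x + g \<Longrightarrow> e dvd y - x"
    and x: "x \<in> D" "N0 \<le> x" and y: "y \<in> D" "N0 \<le> y"
  shows "[x = y] (mod e)"
proof -
  obtain z where z: "z \<in> D" "N0 \<le> z" "z < N0 + g" using gap[OF order_refl] by fastforce
  have step: "[v = u] (mod e)" if "u \<in> D" "v \<in> D" "u \<le> v" "v \<le> u + g" for u v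
  proof (cases "u = v")
    case False
    then have "e dvd v - u" using dv that by simp
    then show ?thesis using that by (simp add: cong_altdef_nat)
  qed simp
  have "[v = z] (mod e)" if "v \<in> D" "N0 \<le> v" for v
    using that
  proof (induction v rule: less_induct)
    case (less v)
    show ?case
    proof (cases "v < N0 + g")
      case True
      then have "v \<le> z + g" "z \<le> v + g" using z less.prems by auto
      then show ?thesis using step[of v z] step[of z v] z less.prems
        by (cases "v \<le> z") (auto intro: cong_sym)
    next
      case False
      then have "N0 \<le> v - g" by simp
      then obtain u where u: "u \<in> D" "v - g \<le> u" "u < v - g + g" using gap by force
      then have "u < v" "N0 \<le> u" "v \<le> u + g" using False by auto
      then have "[u = z] (mod e)" "[v = u] (mod e)" using less.IH u step less.prems by auto
      then show ?thesis using cong_trans by blast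
    qed
  qed
  then show ?thesis using x y by (meson cong_sym cong_trans)
qed

text \<open>Each further summand adds at least one element to the sparsest distant windows until these are
  full, because a window that gains nothing has every difference of \<open>D\<close> up to \<open>g\<close> as a period. The window
  length depends on the gap bound only, and so does the number of summands needed.\<close>

lemma sumset_syndetic_cofinite:
  assumes gap: "\<And>n. n \<ge> N0 \<Longrightarrow> D \<inter> {n..<n + g} \<noteq> {}"
    and gcd: "\<And>e. e \<ge> 2 \<Longrightarrow> \<exists>x\<in>D. \<exists>y\<in>D. x < y \<and> y \<le> x + g \<and> \<not> e dvd y - x"
    and "t \<ge> 1"
  shows "\<forall>\<^sub>F n in sequentially. min t (2 * g) \<le> card (sumset t D \<inter> {n..<n + 2 * g})"
  using \<open>t \<ge> 1\<close>
proof (induction t rule: dec_induct)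
  case base
  have "min 1 (2 * g) \<le> card (sumset 1 D \<inter> {n..<n + 2 * g})" if "n \<ge> N0" for n
  proof -
    have "D \<inter> {n..<n + 2 * g} \<noteq> {}" using gap[OF that] by auto
    then have "card (D \<inter> {n..<n + 2 * g}) > 0" by (simp add: card_gt_0_iff)
    then show ?thesis by (simp add: sumset_1)
  qed
  then show ?case unfolding eventually_sequentially by blast
next
  case (step t)
  define L where "L = 2 * g"
  define S where "S = sumset (Suc t) D"
  define m where "m = min t L"
  obtain N1 where N1: "\<And>n. n \<ge> N1 \<Longrightarrow> m \<le> card (sumset t D \<inter> {n..<n + L})"
    using step.IH unfolding eventually_sequentially m_def L_def by blast
  have shift: "(\<lambda>w. w + c) ` (sumset t D \<inter> {n - c..<n - c + L}) \<subseteq> S \<inter> {n..<n + L}"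
    if "c \<in> D" "c \<le> n" for n c
    using that unfolding S_def by (auto simp: sumset_Suc)
  have card_ge: "m \<le> card (S \<inter> {n..<n + L})" if "c \<in> D" "N1 + c \<le> n" for n c
  proof -
    have "m \<le> card (sumset t D \<inter> {n - c..<n - c + L})" using that by (intro N1) simp
    also have "\<dots> = card ((\<lambda>w. w + c) ` (sumset t D \<inter> {n - c..<n - c + L}))"
      by (rule card_image[symmetric]) (simp add: inj_on_def)
    also have "\<dots> \<le> card (S \<inter> {n..<n + L})" using that by (intro card_mono shift) auto
    finally show ?thesis .
  qed
  \<comment> \<open>If the window of the larger sumset gained nothing, it is a translate of every window of
      the smaller one that lies an element of \<open>D\<close> further left.\<close>
  have translate: "w \<in> S \<longleftrightarrow> w - c \<in> sumset t D"
    if "c \<in> D" "N1 + c \<le> n" "card (S \<inter> {n..<n + L}) = m" "n \<le> w" "w < n + L" for n c w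
  proof -
    have "m \<le> card (sumset t D \<inter> {n - c..<n - c + L})" using that by (intro N1) simp
    also have "\<dots> = card ((\<lambda>w. w + c) ` (sumset t D \<inter> {n - c..<n - c + L}))"
      by (rule card_image[symmetric]) (simp add: inj_on_def)
    finally have "(\<lambda>w. w + c) ` (sumset t D \<inter> {n - c..<n - c + L}) = S \<inter> {n..<n + L}"
      using that by (intro card_seteq shift) auto
    then have "w \<in> S \<longleftrightarrow> w \<in> (\<lambda>w. w + c) ` (sumset t D \<inter> {n - c..<n - c + L})"
      using that by auto
    also have "\<dots> \<longleftrightarrow> w - c \<in> sumset t D"
      using that by (auto simp: image_iff intro!: bexI[of _ "w - c"])
    finally show ?thesis .
  qed
  define H where "H = {y - x | x y. x \<in> D \<and> y \<in> D \<and> x < y \<and> y \<le> x + g}"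
  have "H \<subseteq> {1..g}" unfolding H_def by auto
  then have finH: "finite H" using finite_subset by blast
  have "\<forall>\<^sub>F n in sequentially. card (S \<inter> {n..<n + L}) = m \<longrightarrow> window_period S n L h"
    if h: "h \<in> H" for h
  proof -
    obtain x y where xy: "h = y - x" "x \<in> D" "y \<in> D" "x < y" using h unfolding H_def by blast
    have "window_period S n L h" if n: "n \<ge> N1 + y" "card (S \<inter> {n..<n + L}) = m" for n
      unfolding window_period_def
    proof (intro allI impI)
      fix w assume w: "n \<le> w \<and> w + h < n + L"
      have "w \<in> S \<longleftrightarrow> w - x \<in> sumset t D" using xy n w by (intro translate) auto
      moreover have "w + h \<in> S \<longleftrightarrow> w + h - y \<in> sumset t D" using xy n w by (intro translate) auto
      moreover have "w + h - y = w - x" using xy n w by auto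
      ultimately show "w \<in> S \<longleftrightarrow> w + h \<in> S" by simp
    qed
    then show ?thesis unfolding eventually_sequentially by blast
  qed
  then have ev: "\<forall>\<^sub>F n in sequentially. \<forall>h\<in>H. card (S \<inter> {n..<n + L}) = m \<longrightarrow> window_period S n L h"
    using finH by (intro eventually_ball_finite) auto
  obtain c where c: "c \<in> D" using gap[OF order_refl] by fastforce
  have ev2: "\<forall>\<^sub>F n in sequentially. n \<ge> N1 + c"
    by (rule eventually_ge_at_top)
  show ?case
    using ev ev2
  proof eventually_elim
    case (elim n)
    have ge: "m \<le> card (S \<inter> {n..<n + L})" using card_ge c elim by blast
    show ?case
    proof (cases "m = card (S \<inter> {n..<n + L}) \<and> t < L")
      case True
      have "m \<ge> 1" using True step.hyps unfolding m_def by auto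
      then have "S \<inter> {n..<n + 2 * g} \<noteq> {}" using True unfolding L_def by force
      then have "{n..<n + 2 * g} \<subseteq> S"
      proof (rule window_full[where H = H])
        fix h assume "h \<in> H"
        then show "1 \<le> h \<and> h \<le> g \<and> window_period S n (2 * g) h"
          using elim True \<open>H \<subseteq> {1..g}\<close> unfolding L_def by auto
      next
        fix e :: nat assume "2 \<le> e"
        then show "\<exists>h\<in>H. \<not> e dvd h" using gcd unfolding H_def by blast
      qed
      then have "S \<inter> {n..<n + 2 * g} = {n..<n + 2 * g}" by blast
      then have "card (S \<inter> {n..<n + L}) = L" unfolding L_def by simp
      then show ?thesis unfolding S_def L_def by simp
    next
      case False
      then show ?thesis using ge unfolding m_def S_def L_def by auto
    qed
  qed
qed

text \<open>The sumset of two copies is taken first, because its differences up to \<open>g\<close> already have no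
  common divisor; \<open>2 g\<close> further copies then fill every distant window.\<close>

lemma syndetic_basis:
  assumes gap: "\<And>n. n \<ge> N0 \<Longrightarrow> C \<inter> {n..<n + g} \<noteq> {}" and un: "unconfined C" and "g \<ge> 1"
  shows "\<forall>\<^sub>F n in sequentially. n \<in> sumset (2 * g * 2) C"
proof -
  define D where "D = sumset 2 C"
  obtain c where c: "c \<in> C" using un unconfined_nonempty by blast
  have DI: "x + y \<in> D" if "x \<in> C" "y \<in> C" for x y
    using sumset_add[of x "Suc 0" C y "Suc 0"] that unfolding D_def
    by (simp add: sumset_1 numeral_2_eq_2)
  have gapD: "D \<inter> {n..<n + g} \<noteq> {}" if n: "n \<ge> N0 + c" for n
  proof -
    obtain x where "x \<in> C" "n - c \<le> x" "x < n - c + g" using gap[of "n - c"] n by fastforce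
    then have "x + c \<in> D \<inter> {n..<n + g}" using DI c n by auto
    then show ?thesis by blast
  qed
  \<comment> \<open>The small differences of \<open>C\<close> itself may share a divisor, because finitely many elements
      of \<open>C\<close> can lie in other residue classes; adding a large element moves them into the tail.\<close>
  have gcdD: "\<exists>x\<in>D. \<exists>y\<in>D. x < y \<and> y \<le> x + g \<and> \<not> e dvd y - x" if e: "e \<ge> 2" for e
  proof (rule ccontr)
    assume "\<not> ?thesis"
    then have dv: "\<And>x y. x \<in> D \<Longrightarrow> y \<in> D \<Longrightarrow> x < y \<Longrightarrow> y \<le> x + g \<Longrightarrow> e dvd y - x" by blast
    obtain x y where xy: "x \<in> C" "y \<in> C" "\<not> [x = y] (mod e)"
      using un e unfolding unconfined_def by blast
    obtain z where z: "z \<in> C" "z \<ge> N0 + c" using gap[of "N0 + c"] by fastforce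
    have "[z + x = z + y] (mod e)"
      using gapD dv DI[OF z(1) xy(1)] _ DI[OF z(1) xy(2)]
      by (rule syndetic_congruent) (use z in auto)
    then show False using xy(3) by (simp add: cong_add_lcancel_nat)
  qed
  have "\<forall>\<^sub>F n in sequentially. min (2 * g) (2 * g) \<le> card (sumset (2 * g) D \<inter> {n..<n + 2 * g})"
    by (rule sumset_syndetic_cofinite[OF gapD gcdD]) (use \<open>g \<ge> 1\<close> in auto)
  then show ?thesis
  proof eventually_elim
    case (elim n)
    then have "sumset (2 * g) D \<inter> {n..<n + 2 * g} = {n..<n + 2 * g}"
      by (intro card_seteq) auto
    moreover have "n \<in> {n..<n + 2 * g}" using \<open>g \<ge> 1\<close> by simp
    ultimately have "n \<in> sumset (2 * g) D" by blast
    then show ?case unfolding D_def by (rule sumset_mult)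
  qed
qed

section \<open>Schnirelmann density\<close>

text \<open>Induction on \<open>n\<close>: above the last element \<open>u\<close> of \<open>U\<close> the translate \<open>u + V\<close> contributes its own
  elements to the sumset. This is Schnirelmann's inequality before \<open>card (U \<inter> {1..n})\<close> is replaced
  by its lower bound.\<close>

lemma schnirelmann_count:
  fixes v :: real
  assumes U0: "0 \<in> U" and V0: "0 \<in> V" and v: "\<And>n. v * real n \<le> real (card (V \<inter> {1..n}))"
    and W: "\<And>x y. x \<in> U \<Longrightarrow> y \<in> V \<Longrightarrow> x + y \<in> W"
  shows "real (card (U \<inter> {1..n})) + v * (real n - real (card (U \<inter> {1..n}))) \<le> real (card (W \<inter> {1..n}))"
proof (induction n rule: less_induct)
  case (less n)
  show ?case
  proof (cases "n = 0")
    case False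
    show ?thesis
    proof (cases "n \<in> U")
      case True
      then have "n \<in> W" using W[OF True V0] by simp
      obtain r where r: "n = Suc r" using False by (cases n) auto
      have "U \<inter> {1..n} = insert n (U \<inter> {1..r})" "W \<inter> {1..n} = insert n (W \<inter> {1..r})"
        using True \<open>n \<in> W\<close> r by (auto simp: le_Suc_eq)
      then have "card (U \<inter> {1..n}) = Suc (card (U \<inter> {1..r}))"
        "card (W \<inter> {1..n}) = Suc (card (W \<inter> {1..r}))" using r by auto
      with less.IH[of r] r show ?thesis by simp
    next
      case nU: False
      define u where "u = Max (U \<inter> {0..n})"
      have fin: "finite (U \<inter> {0..n})" "U \<inter> {0..n} \<noteq> {}" using U0 by auto
      then have "u \<in> U \<inter> {0..n}" unfolding u_def by (rule Max_in)
      then have u: "u \<in> U" "u \<le> n" by auto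
      then have un: "u < n" using nU by (metis le_neq_implies_less)
      have umax: "x \<le> u" if "x \<in> U" "x \<le> n" for x
        unfolding u_def using fin(1) that by (intro Max_ge) auto
      have Ueq: "U \<inter> {1..n} = U \<inter> {1..u}" using umax un by force
      have "card (W \<inter> {1..u}) + card (V \<inter> {1..n - u})
          = card (W \<inter> {1..u}) + card ((\<lambda>y. u + y) ` (V \<inter> {1..n - u}))"
        by (simp add: card_image)
      also have "\<dots> = card (W \<inter> {1..u} \<union> (\<lambda>y. u + y) ` (V \<inter> {1..n - u}))"
        by (rule card_Un_disjoint[symmetric]) auto
      also have "\<dots> \<le> card (W \<inter> {1..n})" using W[OF u(1)] un by (intro card_mono) auto
      finally have "card (W \<inter> {1..u}) + card (V \<inter> {1..n - u}) \<le> card (W \<inter> {1..n})" .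
      then have "real (card (W \<inter> {1..u})) + real (card (V \<inter> {1..n - u})) \<le> real (card (W \<inter> {1..n}))"
        by (metis of_nat_add of_nat_le_iff)
      moreover have "v * (real n - real u) \<le> real (card (V \<inter> {1..n - u}))"
        using v[of "n - u"] un by (simp add: of_nat_diff)
      ultimately show ?thesis using less.IH[OF un] unfolding Ueq by (simp add: algebra_simps)
    qed
  qed simp
qed

lemma schnirelmann_iterate:
  fixes \<beta> :: real
  assumes U0: "0 \<in> U" and \<beta>: "0 \<le> \<beta>" "\<beta> \<le> 1" and d: "\<And>n. \<beta> * real n \<le> real (card (U \<inter> {1..n}))"
  shows "0 \<in> sumset i U \<and> (\<forall>n. (1 - (1 - \<beta>) ^ i) * real n \<le> real (card (sumset i U \<inter> {1..n})))"
proof (induction i)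
  case (Suc i)
  have 0: "0 \<in> sumset (Suc i) U" using Suc U0 by (auto simp: sumset_Suc)
  have "(1 - (1 - \<beta>) ^ Suc i) * real n \<le> real (card (sumset (Suc i) U \<inter> {1..n}))" for n
  proof -
    let ?c = "real (card (sumset i U \<inter> {1..n}))"
    have "(1 - (1 - \<beta>) ^ i) * real n \<le> ?c" using Suc by blast
    then have "(1 - \<beta>) * ((1 - (1 - \<beta>) ^ i) * real n) \<le> (1 - \<beta>) * ?c"
      using \<beta> by (intro mult_left_mono) auto
    then have "(1 - (1 - \<beta>) ^ Suc i) * real n \<le> ?c + \<beta> * (real n - ?c)"
      by (simp add: algebra_simps)
    also have "\<dots> \<le> real (card (sumset (Suc i) U \<inter> {1..n}))"
      using Suc U0 d by (intro schnirelmann_count[where V = U]) (auto simp: sumset_Suc)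
    finally show ?thesis .
  qed
  with 0 show ?case by blast
qed (simp add: sumset_0)

text \<open>If \<open>n\<close> is not in \<open>W\<close>, then \<open>W\<close> and \<open>n - W\<close> both fill more than half of \<open>{1..n - 1}\<close>, so they meet.\<close>

lemma dense_half_sum:
  assumes "0 \<in> W" and d: "\<And>n. n \<ge> 1 \<Longrightarrow> real n < 2 * real (card (W \<inter> {1..n}))"
  shows "\<exists>x\<in>W. \<exists>y\<in>W. n = x + y"
proof (cases "n \<in> W")
  case False
  then have n: "n \<ge> 1" using \<open>0 \<in> W\<close> by (cases n) auto
  have eq: "W \<inter> {1..n} = W \<inter> {1..n - 1}"
    using False n by (cases n) (auto simp: le_Suc_eq)
  have big: "n < 2 * card (W \<inter> {1..n - 1})" using d[OF n] unfolding eq by linarith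
  let ?A = "W \<inter> {1..n - 1}" and ?B = "(\<lambda>x. n - x) ` (W \<inter> {1..n - 1})"
  have cB: "card ?B = card ?A"
    by (rule card_image) (auto simp: inj_on_def)
  have "?A \<inter> ?B \<noteq> {}"
  proof
    assume "?A \<inter> ?B = {}"
    then have "card (?A \<union> ?B) = card ?A + card ?B" by (intro card_Un_disjoint) auto
    moreover have "card (?A \<union> ?B) \<le> card {1..n - 1}" by (intro card_mono) auto
    ultimately show False using cB big by simp
  qed
  then obtain x where x: "x \<in> W" "x \<in> ?B" by blast
  then obtain y where "y \<in> W" "x = n - y" "y \<le> n - 1" by auto
  then show ?thesis using n x(1) by (intro bexI[of _ x] bexI[of _ y]) auto
next
  case True
  then show ?thesis using \<open>0 \<in> W\<close> by (metis add.right_neutral)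
qed

lemma schnirelmann_basis:
  fixes \<beta> :: real
  assumes "0 < \<beta>"
  obtains j where "j \<ge> 1"
    "\<And>U m. 0 \<in> U \<Longrightarrow> (\<And>n. \<beta> * real n \<le> real (card (U \<inter> {1..n}))) \<Longrightarrow> m \<in> sumset j U"
proof -
  define b where "b = min \<beta> 1"
  have b: "0 < b" "b \<le> 1" using assms unfolding b_def by auto
  obtain i where i: "(1 - b) ^ i < 1 / 2"
    using real_arch_pow_inv[of "1/2" "1 - b"] b by auto
  have "i \<noteq> 0" using i by (cases i) auto
  show thesis
  proof (rule that[of "2 * i"])
    fix U :: "nat set" and m
    assume U: "0 \<in> U" "\<And>n. \<beta> * real n \<le> real (card (U \<inter> {1..n}))"
    have "b * real n \<le> real (card (U \<inter> {1..n}))" for n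
      using U(2)[of n] mult_right_mono[of b \<beta> "real n"] unfolding b_def by simp
    then have it: "0 \<in> sumset i U"
      "\<And>n. (1 - (1 - b) ^ i) * real n \<le> real (card (sumset i U \<inter> {1..n}))"
      using schnirelmann_iterate[OF U(1), of b i] b by auto
    have "real n < 2 * real (card (sumset i U \<inter> {1..n}))" if "n \<ge> 1" for n
    proof -
      have "1 / 2 * real n < (1 - (1 - b) ^ i) * real n"
        using i that by (intro mult_strict_right_mono) auto
      then show ?thesis using it(2)[of n] by simp
    qed
    then obtain x y where "x \<in> sumset i U" "y \<in> sumset i U" "m = x + y"
      using dense_half_sum[OF it(1)] by blast
    then show "m \<in> sumset (2 * i) U" using sumset_add by (simp add: mult_2)
  qed (use \<open>i \<noteq> 0\<close> in simp)
qed

text \<open>The excess of the counting function over the line of slope \<open>\<gamma>\<close> tends to infinity, so it is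
  smaller at some point than at all later ones; seen from there, the set is dense at every scale.\<close>

lemma schnirelmann_origin:
  fixes \<beta> \<gamma> :: real
  assumes "0 \<le> \<gamma>" "\<gamma> < \<beta>" and d: "\<And>N. N \<ge> N0 \<Longrightarrow> \<beta> * real N \<le> real (card (B \<inter> {1..N}))"
  obtains n where "\<And>m. m \<ge> 1 \<Longrightarrow> \<gamma> * real m < real (card (B \<inter> {n + 1..n + m}))"
proof -
  define f where "f N = real (card (B \<inter> {1..N})) - \<gamma> * real N" for N
  have "\<exists>n. \<forall>m\<ge>1. f n < f (n + m)"
  proof (rule ccontr)
    assume "\<not> ?thesis"
    then have down: "\<exists>m\<ge>1. f (n + m) \<le> f n" for n by (meson not_less)
    have "\<exists>n\<ge>K. f n \<le> 0" for K
    proof (induction K)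
      case 0
      show ?case by (intro exI[of _ 0]) (simp add: f_def)
    next
      case (Suc K)
      then obtain n where n: "n \<ge> K" "f n \<le> 0" by blast
      obtain m where "m \<ge> 1" "f (n + m) \<le> f n" using down by blast
      then show ?case using n by (intro exI[of _ "n + m"]) auto
    qed
    then obtain n where n: "n \<ge> Suc N0" "f n \<le> 0" by blast
    then have "\<beta> * real n \<le> real (card (B \<inter> {1..n}))" by (intro d) auto
    moreover have "\<gamma> * real n < \<beta> * real n" using n assms by (intro mult_strict_right_mono) auto
    ultimately show False using n(2) unfolding f_def by linarith
  qed
  then obtain n where n: "\<And>m. m \<ge> 1 \<Longrightarrow> f n < f (n + m)" by blast
  show thesis
  proof (rule that[of n])
    fix m :: nat assume "m \<ge> 1"
    have "B \<inter> {1..n + m} = B \<inter> {1..n} \<union> B \<inter> {n + 1..n + m}" by auto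
    then have "card (B \<inter> {1..n + m}) = card (B \<inter> {1..n}) + card (B \<inter> {n + 1..n + m})"
      by (simp add: card_Un_disjoint disjoint_iff)
    then show "\<gamma> * real m < real (card (B \<inter> {n + 1..n + m}))"
      using n[OF \<open>m \<ge> 1\<close>] unfolding f_def by (simp add: algebra_simps)
  qed
qed

text \<open>The element \<open>0\<close> of the shifted set stands for \<open>n\<close>, which may be missing from \<open>B\<close>; using \<open>n + 1\<close>
  in its place shifts the sum by one each time, by \<open>z\<close> in total.\<close>

lemma sumset_unshift:
  assumes "n + 1 \<in> B" "m \<in> sumset j {u. u = 0 \<or> u + n \<in> B}"
  shows "\<exists>z\<le>j. m + j * n + z \<in> sumset j B"
  using assms(2)
proof (induction j arbitrary: m)
  case (Suc j)
  then obtain x u where xu: "m = x + u" "x \<in> sumset j {u. u = 0 \<or> u + n \<in> B}" "u = 0 \<or> u + n \<in> B"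
    by (auto simp: sumset_Suc)
  obtain z where z: "z \<le> j" "x + j * n + z \<in> sumset j B" using Suc.IH xu by blast
  show ?case
  proof (cases "u + n \<in> B")
    case True
    then have "(x + j * n + z) + (u + n) \<in> sumset (Suc j) B" using z by (auto simp: sumset_Suc)
    then show ?thesis using z xu by (intro exI[of _ z]) (simp add: algebra_simps)
  next
    case False
    then have "u = 0" using xu by blast
    have "(x + j * n + z) + (n + 1) \<in> sumset (Suc j) B" using z assms(1) unfolding sumset_Suc by blast
    then show ?thesis using z xu \<open>u = 0\<close> by (intro exI[of _ "Suc z"]) (simp add: algebra_simps)
  qed
qed (simp add: sumset_0)

lemma positive_density_basis:
  fixes \<beta> :: real
  assumes "0 < \<beta>"
  obtains t where "t \<ge> 1"
    "\<And>B N0. (\<And>N. N \<ge> N0 \<Longrightarrow> \<beta> * real N \<le> real (card (B \<inter> {1..N}))) \<Longrightarrow> unconfined B \<Longrightarrow>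
       \<forall>\<^sub>F n in sequentially. n \<in> sumset t B"
proof -
  obtain j where j: "j \<ge> 1"
    "\<And>U m. 0 \<in> U \<Longrightarrow> (\<And>n. \<beta> / 2 * real n \<le> real (card (U \<inter> {1..n}))) \<Longrightarrow> m \<in> sumset j U"
    using schnirelmann_basis[of "\<beta> / 2"] assms by auto
  show thesis
  proof (rule that[of "2 * (j + 1) * 2 * j"])
    fix B :: "nat set" and N0 :: nat
    assume d: "\<And>N. N \<ge> N0 \<Longrightarrow> \<beta> * real N \<le> real (card (B \<inter> {1..N}))" and un: "unconfined B"
    obtain n where n: "\<And>m. m \<ge> 1 \<Longrightarrow> \<beta> / 2 * real m < real (card (B \<inter> {n + 1..n + m}))"
      using schnirelmann_origin[of "\<beta> / 2" \<beta> N0 B] d assms by auto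
    have "0 < real (card (B \<inter> {n + 1..n + 1}))"
      using n[of 1] assms by (simp del: of_nat_0_less_iff)
    then have nB: "n + 1 \<in> B" by (cases "n + 1 \<in> B") auto
    define U where "U = {u. u = 0 \<or> u + n \<in> B}"
    have "\<beta> / 2 * real m \<le> real (card (U \<inter> {1..m}))" for m
    proof (cases "m = 0")
      case False
      have "B \<inter> {n + 1..n + m} = (\<lambda>u. u + n) ` (U \<inter> {1..m})"
      proof (intro equalityI subsetI)
        fix x assume "x \<in> B \<inter> {n + 1..n + m}"
        then show "x \<in> (\<lambda>u. u + n) ` (U \<inter> {1..m})"
          unfolding U_def by (intro image_eqI[of _ _ "x - n"]) auto
      qed (auto simp: U_def)
      then have "card (B \<inter> {n + 1..n + m}) = card (U \<inter> {1..m})" by (simp add: card_image)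
      then show ?thesis using n[of m] False by simp
    qed simp
    then have all: "m \<in> sumset j U" for m using j(2)[of U m] unfolding U_def by blast
    have "sumset j B \<inter> {m..<m + (j + 1)} \<noteq> {}" if m: "m \<ge> j * n" for m
    proof -
      obtain z where "z \<le> j" "(m - j * n) + j * n + z \<in> sumset j B"
        using sumset_unshift[OF nB] all[of "m - j * n"] unfolding U_def by blast
      then have "m + z \<in> sumset j B \<inter> {m..<m + (j + 1)}" using m by auto
      then show ?thesis by blast
    qed
    then have "\<forall>\<^sub>F n in sequentially. n \<in> sumset (2 * (j + 1) * 2) (sumset j B)"
      using unconfined_sumset[OF un j(1)] by (intro syndetic_basis[where ?N0.0 = "j * n"]) auto
    then show "\<forall>\<^sub>F n in sequentially. n \<in> sumset (2 * (j + 1) * 2 * j) B"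
      by eventually_elim (rule sumset_mult)
  qed (use j(1) in simp)
qed

section \<open>Iterated differences\<close>

text \<open>A polynomial of degree at most \<open>d\<close> is recorded only through its \<open>d\<close>-fold differences, which are
  constant; \<open>\<gamma>\<close> is \<open>fact d\<close> times the coefficient of degree \<open>d\<close>. Weyl differencing thereby becomes
  an unfolding of the recursion, and no coefficients have to be tracked.\<close>

fun diff_lead :: "nat \<Rightarrow> real \<Rightarrow> (int \<Rightarrow> real) \<Rightarrow> bool" where
  "diff_lead 0 \<gamma> f \<longleftrightarrow> (\<forall>x. f x = \<gamma>)"
| "diff_lead (Suc d) \<gamma> f \<longleftrightarrow> (\<forall>h. diff_lead d (\<gamma> * of_int h) (\<lambda>x. f (x + h) - f x))"

lemma diff_lead_add: "diff_lead d \<gamma> f \<Longrightarrow> diff_lead d \<eta> g \<Longrightarrow> diff_lead d (\<gamma> + \<eta>) (\<lambda>x. f x + g x)"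
proof (induction d arbitrary: \<gamma> \<eta> f g)
  case (Suc d)
  have "diff_lead d ((\<gamma> + \<eta>) * of_int h) (\<lambda>x. (f (x + h) + g (x + h)) - (f x + g x))" for h
  proof -
    have "diff_lead d (\<gamma> * of_int h + \<eta> * of_int h) (\<lambda>x. (f (x + h) - f x) + (g (x + h) - g x))"
      using Suc.prems by (intro Suc.IH) auto
    moreover have "(\<lambda>x. (f (x + h) - f x) + (g (x + h) - g x)) = (\<lambda>x. (f (x + h) + g (x + h)) - (f x + g x))"
      by auto
    ultimately show ?thesis by (simp add: distrib_right)
  qed
  then show ?case by simp
qed simp

lemma diff_lead_scale: "diff_lead d \<gamma> f \<Longrightarrow> diff_lead d (c * \<gamma>) (\<lambda>x. c * f x)"
proof (induction d arbitrary: \<gamma> f)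
  case (Suc d)
  have "diff_lead d (c * \<gamma> * of_int h) (\<lambda>x. c * f (x + h) - c * f x)" for h
  proof -
    have "diff_lead d (c * (\<gamma> * of_int h)) (\<lambda>x. c * (f (x + h) - f x))"
      using Suc.prems by (intro Suc.IH) auto
    then show ?thesis by (simp add: right_diff_distrib mult.assoc)
  qed
  then show ?case by simp
qed simp

lemma diff_lead_translate: "diff_lead d \<gamma> f \<Longrightarrow> diff_lead d \<gamma> (\<lambda>x. f (x + a))"
proof (induction d arbitrary: \<gamma> f)
  case (Suc d)
  have "diff_lead d (\<gamma> * of_int h) (\<lambda>x. f (x + h + a) - f (x + a))" for h
  proof -
    have "diff_lead d (\<gamma> * of_int h) (\<lambda>x. f (x + a + h) - f (x + a))"
      using Suc.prems by (intro Suc.IH) auto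
    then show ?thesis by (simp add: ac_simps)
  qed
  then show ?case by simp
qed simp

text \<open>Multiplication by the variable obeys a Leibniz rule: the difference of \<open>x f x\<close> is
  \<open>x\<close> times the difference of \<open>f\<close>, plus \<open>h\<close> times a translate of \<open>f\<close>.\<close>

lemma diff_lead_times_id:
  "diff_lead d \<gamma> f \<Longrightarrow> diff_lead (Suc d) (real (Suc d) * \<gamma>) (\<lambda>x. of_int x * f x)"
proof (induction d arbitrary: \<gamma> f)
  case 0
  then show ?case by (auto simp: algebra_simps)
next
  case (Suc d)
  have "diff_lead (Suc d) (real (Suc (Suc d)) * \<gamma> * of_int h)
      (\<lambda>x. of_int (x + h) * f (x + h) - of_int x * f x)" for h
  proof -
    have "diff_lead (Suc d) (real (Suc d) * (\<gamma> * of_int h)) (\<lambda>x. of_int x * (f (x + h) - f x))"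
      using Suc.prems by (intro Suc.IH) auto
    moreover have "diff_lead (Suc d) (of_int h * \<gamma>) (\<lambda>x. of_int h * f (x + h))"
      by (intro diff_lead_scale diff_lead_translate Suc.prems)
    ultimately have "diff_lead (Suc d) (real (Suc d) * (\<gamma> * of_int h) + of_int h * \<gamma>)
        (\<lambda>x. of_int x * (f (x + h) - f x) + of_int h * f (x + h))"
      by (rule diff_lead_add)
    moreover have "(\<lambda>x. of_int x * (f (x + h) - f x) + of_int h * f (x + h)) =
        (\<lambda>x. of_int (x + h) * f (x + h) - of_int x * f x)"
      by (auto simp: algebra_simps)
    moreover have "real (Suc d) * (\<gamma> * of_int h) + of_int h * \<gamma> = real (Suc (Suc d)) * \<gamma> * of_int h"
      by (simp add: algebra_simps)
    ultimately show ?thesis by metis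
  qed
  then show ?case by (subst diff_lead.simps) blast
qed

lemma diff_lead_power: "diff_lead d (fact d * \<alpha>) (\<lambda>x. \<alpha> * of_int x ^ d)"
proof (induction d)
  case (Suc d)
  have "(\<lambda>x. of_int x * (\<alpha> * of_int x ^ d)) = (\<lambda>x. \<alpha> * of_int x ^ Suc d)"
    by auto
  moreover have "real (Suc d) * (fact d * \<alpha>) = fact (Suc d) * \<alpha>"
    by simp
  ultimately show ?case using diff_lead_times_id[OF Suc] by metis
qed simp

section \<open>Exponential sums\<close>

definition expi2 :: "real \<Rightarrow> complex" where
  "expi2 t = cis (2 * pi * t)"

lemma norm_expi2 [simp]: "norm (expi2 t) = 1"
  by (simp add: expi2_def)

lemma expi2_add: "expi2 (s + t) = expi2 s * expi2 t"
  by (simp add: expi2_def cis_mult distrib_left)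

lemma expi2_diff: "expi2 (s - t) = expi2 s * cnj (expi2 t)"
  by (simp add: expi2_def cis_cnj cis_mult right_diff_distrib)

lemma expi2_int [simp]: "expi2 (of_int n) = 1"
  by (simp add: expi2_def cis.ctr complex_eq_iff sin_times_pi_eq_0 cos_int_2pin sin_int_2pin)

lemma abs_sin_pi_ge:
  assumes "\<bar>t\<bar> \<le> 1 / 2"
  shows "\<bar>t\<bar> \<le> \<bar>sin (pi * t)\<bar>"
proof -
  have *: "t \<le> sin (pi * t)" if "0 \<le> t" "t \<le> 1 / 2" for t
  proof (cases "t \<le> 1 / 3")
    case True
    let ?g = "\<lambda>x. sin x - x / 2"
    have "?g 0 \<le> ?g (pi * t)"
    proof (rule DERIV_nonneg_imp_nondecreasing[where f = ?g])
      fix x assume x: "0 \<le> x" "x \<le> pi * t"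
      have "pi * t \<le> pi * (1 / 3)" using True by (intro mult_left_mono) auto
      then have "x \<le> pi / 3" using x by linarith
      then have "cos (pi / 3) \<le> cos x" using x by (intro cos_monotone_0_pi_le) auto
      then have "0 \<le> cos x - 1 / 2" by (simp add: cos_60)
      then show "\<exists>y. (?g has_real_derivative y) (at x) \<and> 0 \<le> y"
        by (intro exI[of _ "cos x - 1 / 2"]) (auto intro!: derivative_eq_intros)
    qed (use that in simp)
    moreover have "2 * t \<le> pi * t" using that pi_ge_two by (intro mult_right_mono) auto
    ultimately show ?thesis by simp
  next
    case False
    have "sin (pi / 6) \<le> sin (pi * t)"
      using False that by (intro sin_monotone_2pi_le) (auto simp: field_simps)
    then show ?thesis using that by (simp add: sin_30)
  qed
  show ?thesis
  proof (cases "0 \<le> t")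
    case True
    then show ?thesis using *[of t] assms by auto
  next
    case False
    then show ?thesis using *[of "- t"] assms by auto
  qed
qed

lemma norm_one_minus_expi2: "norm (1 - expi2 t) = 2 * \<bar>sin (pi * t)\<bar>"
proof -
  have "(norm (1 - expi2 t))\<^sup>2 = (1 - cos (2 * (pi * t)))\<^sup>2 + (sin (2 * (pi * t)))\<^sup>2"
    by (simp add: expi2_def cmod_power2 mult.assoc)
  also have "\<dots> = 2 - 2 * cos (2 * (pi * t))"
    using sin_cos_squared_add[of "2 * (pi * t)"] by (simp add: power2_eq_square algebra_simps)
  also have "\<dots> = (2 * \<bar>sin (pi * t)\<bar>)\<^sup>2"
    by (simp add: cos_double_sin power_mult_distrib)
  finally show ?thesis by (rule power2_eq_imp_eq) auto
qed

text \<open>The bound is stated as a product because the distance of \<open>\<beta>\<close> to the nearest integer may vanish.\<close>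

lemma geometric_expi2_bound:
  "2 * \<bar>\<beta> - of_int (round \<beta>)\<bar> * norm (\<Sum>i<l. expi2 (c + real i * \<beta>)) \<le> 2"
proof -
  define \<theta> where "\<theta> = \<beta> - of_int (round \<beta>)"
  define z where "z = expi2 \<beta>"
  have z: "z = expi2 \<theta>"
    using expi2_add[of \<theta> "of_int (round \<beta>)"] unfolding z_def \<theta>_def by simp
  have pw: "expi2 (c + real i * \<beta>) = expi2 c * z ^ i" for i
  proof -
    have "z ^ i = expi2 (real i * \<beta>)"
      unfolding z_def expi2_def Complex.DeMoivre by (simp add: mult_ac)
    then show ?thesis by (simp add: expi2_add)
  qed
  have "\<bar>\<theta>\<bar> \<le> 1 / 2"
    unfolding \<theta>_def using of_int_round_abs_le[of \<beta>] by (simp add: abs_minus_commute)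
  then have "2 * \<bar>\<theta>\<bar> \<le> norm (1 - z)"
    unfolding z norm_one_minus_expi2 using abs_sin_pi_ge by auto
  then have "2 * \<bar>\<theta>\<bar> * norm (\<Sum>i<l. z ^ i) \<le> norm (1 - z) * norm (\<Sum>i<l. z ^ i)"
    by (intro mult_right_mono) auto
  also have "\<dots> = norm (1 - z ^ l)"
    by (simp add: one_diff_power_eq norm_mult)
  also have "\<dots> \<le> norm (1::complex) + norm (z ^ l)" by (rule norm_triangle_ineq4)
  also have "\<dots> = 2" by (simp add: norm_power z)
  finally have "2 * \<bar>\<theta>\<bar> * norm (\<Sum>i<l. z ^ i) \<le> 2" .
  moreover have "norm (\<Sum>i<l. expi2 (c + real i * \<beta>)) = norm (\<Sum>i<l. z ^ i)"
    unfolding pw by (simp add: sum_distrib_left[symmetric] norm_mult)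
  ultimately show ?thesis unfolding \<theta>_def by simp
qed

text \<open>Choose a fraction \<open>a / q\<close> with \<open>q \<le> 2 N\<close> by Dirichlet's theorem, so that \<open>q \<beta> h\<close> differs from
  \<open>a h\<close> by at most \<open>1 / 2\<close> for all \<open>h \<le> N\<close>. For \<open>h\<close> in \<open>H\<close> the residue of \<open>a h\<close> modulo \<open>q\<close> is then small,
  and there are too few small residues unless \<open>q\<close> is bounded in terms of \<open>\<eta>\<close>. For such a small \<open>q\<close> the
  residue must vanish, so \<open>q \<beta> - a\<close> multiplied by a large element of \<open>H\<close> is still at most \<open>q \<epsilon>\<close>.\<close>

lemma vinogradov_lemma:
  fixes \<beta> \<epsilon> \<eta> :: real and N :: nat
  assumes N: "N \<ge> 1" and \<eta>: "0 < \<eta>" and H: "H \<subseteq> {1..N}" "\<eta> * real N \<le> real (card H)"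
    and near: "\<And>h. h \<in> H \<Longrightarrow> \<exists>z::int. \<bar>\<beta> * real h - of_int z\<bar> \<le> \<epsilon>"
    and small: "24 * \<epsilon> \<le> \<eta>"
  obtains q :: nat and z :: int where "1 \<le> q" "\<eta> * real q \<le> 8"
    "\<bar>real q * \<beta> - of_int z\<bar> * (\<eta> * real N) \<le> real q * \<epsilon>"
proof -
  have finH: "finite H" using H(1) finite_subset by blast
  have "0 < \<eta> * real N" using \<eta> N by simp
  then have Hne: "H \<noteq> {}" using H(2) by auto
  then have \<epsilon>0: "0 \<le> \<epsilon>" using near by fastforce
  obtain a k where ak: "coprime a k" "0 < k" "k \<le> int (2 * N)"
    and dk: "\<bar>of_int k * \<beta> - of_int a\<bar> < 1 / real (2 * N)"
    using Dirichlet_approx_coprime[of "2 * N" \<beta>] N by auto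
  define \<delta> where "\<delta> = of_int k * \<beta> - of_int a"
  define q where "q = nat k"
  have q: "1 \<le> q" "int q = k" "q \<le> 2 * N" using ak unfolding q_def by auto
  then have rq: "real q = of_int k" by (metis of_int_of_nat_eq)
  obtain zf where zf: "\<And>h. h \<in> H \<Longrightarrow> \<bar>\<beta> * real h - of_int (zf h)\<bar> \<le> \<epsilon>"
    using near by metis
  \<comment> \<open>congruent to \<open>a h\<close> modulo \<open>k\<close>, and small because \<open>\<beta> h\<close> is near \<open>zf h\<close>\<close>
  define u where "u h = a * int h - k * zf h" for h
  have u_eq: "of_int (u h) = real q * (\<beta> * real h - of_int (zf h)) - \<delta> * real h" for h
    unfolding u_def \<delta>_def rq by (simp add: algebra_simps)
  have \<delta>h: "\<bar>\<delta> * real h\<bar> \<le> 1 / 2" if "h \<in> H" for h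
  proof -
    have "\<bar>\<delta> * real h\<bar> \<le> 1 / real (2 * N) * real N"
      unfolding abs_mult using dk that H(1) unfolding \<delta>_def by (intro mult_mono) auto
    then show ?thesis using N by simp
  qed
  have qz: "\<bar>real q * (\<beta> * real h - of_int (zf h))\<bar> \<le> real q * \<epsilon>" if "h \<in> H" for h
    unfolding abs_mult using zf[OF that] by (intro mult_mono) auto
  have u_le: "\<bar>of_int (u h)\<bar> \<le> real q * \<epsilon> + 1 / 2" if "h \<in> H" for h
    unfolding u_eq using \<delta>h[OF that] qz[OF that] by linarith
  define K where "K = \<lfloor>real q * \<epsilon> + 1 / 2\<rfloor>"
  have K0: "0 \<le> K" unfolding K_def using \<epsilon>0 by simp
  have uK: "u h \<in> {-K..K}" if "h \<in> H" for h
  proof -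
    have "\<bar>u h\<bar> \<le> K" unfolding K_def le_floor_iff using u_le[OF that] by simp
    then show ?thesis by auto
  qed
  have "inj_on (\<lambda>h. (h div q, u h)) H"
  proof (rule inj_onI)
    fix h h' assume h: "h \<in> H" "h' \<in> H" "(h div q, u h) = (h' div q, u h')"
    then have "a * int h - k * zf h = a * int h' - k * zf h'" unfolding u_def by simp
    then have "a * (int h - int h') = k * (zf h - zf h')" by (simp add: algebra_simps)
    then have "k dvd a * (int h - int h')" by simp
    then have "k dvd int h - int h'"
      using ak(1) by (simp add: coprime_commute coprime_dvd_mult_right_iff)
    then have "int h mod int q = int h' mod int q" using q(2) by (simp add: mod_eq_dvd_iff)
    then have "h mod q = h' mod q" by (metis of_nat_eq_iff of_nat_mod)
    then show "h = h'" using h(3) by (metis div_mult_mod_eq prod.inject)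
  qed
  moreover have "(\<lambda>h. (h div q, u h)) ` H \<subseteq> {0..N div q} \<times> {-K..K}"
  proof (clarify)
    fix h assume h: "h \<in> H"
    then have "h \<le> N" using H(1) by auto
    then show "h div q \<in> {0..N div q} \<and> u h \<in> {-K..K}" using uK[OF h] by (simp add: div_le_mono)
  qed
  ultimately have "card H \<le> card ({0..N div q} \<times> {-K..K})"
    by (intro card_inj_on_le) auto
  also have "\<dots> = (N div q + 1) * nat (2 * K + 1)" by (simp add: card_cartesian_product)
  finally have "real (card H) \<le> real ((N div q + 1) * nat (2 * K + 1))" by (rule of_nat_mono)
  also have "\<dots> = (real (N div q) + 1) * (2 * of_int K + 1)" using K0 by (simp add: algebra_simps)
  also have "\<dots> \<le> (3 * (real N / real q)) * (2 * (real q * \<epsilon>) + 2)"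
  proof (rule mult_mono)
    have "real (N div q) \<le> real N / real q" by (simp add: of_nat_div_le_of_nat)
    moreover have "1 \<le> 2 * (real N / real q)" using q N by (simp add: field_simps)
    ultimately show "real (N div q) + 1 \<le> 3 * (real N / real q)" by linarith
    have "of_int K \<le> real q * \<epsilon> + 1 / 2" unfolding K_def by (rule of_int_floor_le)
    then show "2 * of_int K + 1 \<le> 2 * (real q * \<epsilon>) + 2" by linarith
  qed (use K0 in auto)
  also have "\<dots> = 6 * \<epsilon> * real N + 6 * real N / real q" using q by (simp add: field_simps)
  finally have "\<eta> * real N \<le> 6 * \<epsilon> * real N + 6 * real N / real q" using H(2) by linarith
  then have "real N * \<eta> \<le> real N * (6 * \<epsilon> + 6 / real q)" by (simp add: algebra_simps)
  then have "\<eta> \<le> 6 * \<epsilon> + 6 / real q" using N by simp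
  then have "3 / 4 * \<eta> \<le> 6 / real q" using small by linarith
  then have q8: "\<eta> * real q \<le> 8" using q by (simp add: field_simps)
  have q\<epsilon>: "real q * \<epsilon> \<le> 1 / 3"
  proof -
    have "24 * (real q * \<epsilon>) \<le> \<eta> * real q" using mult_left_mono[OF small, of "real q"] by (simp add: mult_ac)
    then show ?thesis using q8 by linarith
  qed
  have u0: "u h = 0" if "h \<in> H" for h
  proof -
    have "\<bar>of_int (u h) :: real\<bar> < 1" using u_le[OF that] q\<epsilon> by linarith
    then show ?thesis by linarith
  qed
  have "\<bar>\<delta>\<bar> * (\<eta> * real N) \<le> real q * \<epsilon>"
  proof -
    define h where "h = Max H"
    have h: "h \<in> H" unfolding h_def using finH Hne by simp
    have "H \<subseteq> {1..h}" unfolding h_def using H(1) finH by auto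
    then have "card H \<le> h" using card_mono[of "{1..h}" H] by simp
    then have "\<eta> * real N \<le> real h" using H(2) by linarith
    then have "\<bar>\<delta>\<bar> * (\<eta> * real N) \<le> \<bar>\<delta> * real h\<bar>" by (simp add: abs_mult mult_left_mono)
    also have "\<dots> = \<bar>real q * (\<beta> * real h - of_int (zf h))\<bar>" using u_eq[of h] u0[OF h] by simp
    also have "\<dots> \<le> real q * \<epsilon>" by (rule qz[OF h])
    finally show ?thesis .
  qed
  then show thesis using that[of q a] q(1) q8 unfolding \<delta>_def rq by auto
qed

lemma van_der_corput:
  fixes g :: "nat \<Rightarrow> complex"
  assumes g: "\<And>i. norm (g i) = 1"
  shows "(norm (\<Sum>i<l. g i))\<^sup>2 \<le> real l + 2 * (\<Sum>h\<in>{1..<l}. norm (\<Sum>j<l - h. g (j + h) * cnj (g j)))"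
proof -
  have sq: "(norm (\<Sum>i<l. g i))\<^sup>2 = real l + 2 * Re (\<Sum>i<l. \<Sum>j<i. g i * cnj (g j))" for l
  proof (induction l)
    case (Suc l)
    have "(norm (s + z))\<^sup>2 = (norm s)\<^sup>2 + (norm z)\<^sup>2 + 2 * Re (z * cnj s)" for s z
      unfolding cmod_power2 by (simp add: power2_eq_square algebra_simps)
    then have "(norm (\<Sum>i<Suc l. g i))\<^sup>2 = (norm (\<Sum>i<l. g i))\<^sup>2 + (norm (g l))\<^sup>2 + 2 * Re (g l * cnj (\<Sum>i<l. g i))"
      by (simp only: sum.lessThan_Suc)
    then show ?case using Suc g[of l] by (simp add: sum_distrib_left)
  qed simp
  have reindex: "(\<Sum>i<l. \<Sum>j<i. g i * cnj (g j)) = (\<Sum>h\<in>{1..<l}. \<Sum>j<l - h. g (j + h) * cnj (g j))"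
    unfolding sum.Sigma[OF finite_lessThan ballI[OF finite_lessThan]] sum.Sigma[OF finite_atLeastLessThan ballI[OF finite_lessThan]]
    by (rule sum.reindex_bij_witness[where i = "\<lambda>(h, j). (j + h, j)" and j = "\<lambda>(i, j). (i - j, j)"]) auto
  have "Re (\<Sum>h\<in>{1..<l}. \<Sum>j<l - h. g (j + h) * cnj (g j))
      \<le> (\<Sum>h\<in>{1..<l}. norm (\<Sum>j<l - h. g (j + h) * cnj (g j)))"
    by (rule order_trans[OF complex_Re_le_cmod norm_sum])
  then show ?thesis unfolding sq reindex by linarith
qed

lemma pigeonhole_fibre:
  fixes q :: "'a \<Rightarrow> nat" and P :: real
  assumes "finite H" "H \<noteq> {}" and q: "\<And>h. h \<in> H \<Longrightarrow> 1 \<le> q h \<and> real (q h) \<le> P"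
  obtains v where "v \<in> q ` H" "real (card H) \<le> P * real (card {h \<in> H. q h = v})"
proof -
  have P: "real (card (q ` H)) \<le> P"
  proof -
    have "q ` H \<subseteq> {1..nat \<lfloor>P\<rfloor>}" using q by (auto simp: le_nat_floor)
    then have "card (q ` H) \<le> nat \<lfloor>P\<rfloor>" using card_mono[of "{1..nat \<lfloor>P\<rfloor>}"] by simp
    moreover obtain h where "h \<in> H" using assms by blast
    then have "0 \<le> P" using q[of h] by linarith
    ultimately show ?thesis by linarith
  qed
  have "\<exists>v\<in>q ` H. real (card H) \<le> P * real (card {h \<in> H. q h = v})"
  proof (rule ccontr)
    assume "\<not> ?thesis"
    then have lt: "P * real (card {h \<in> H. q h = v}) < real (card H)" if "v \<in> q ` H" for v
      using that by (meson not_le)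
    have "card H = (\<Sum>v\<in>q ` H. card {h \<in> H. q h = v})"
      using sum.image_gen[OF \<open>finite H\<close>, of "\<lambda>_. 1::nat" q] by simp
    then have "P * real (card H) = (\<Sum>v\<in>q ` H. P * real (card {h \<in> H. q h = v}))"
      by (simp add: sum_distrib_left)
    also have "\<dots> < (\<Sum>v\<in>q ` H. real (card H))" using assms lt by (intro sum_strict_mono) auto
    also have "\<dots> \<le> P * real (card H)" using P by (simp add: mult_right_mono)
    finally show False by simp
  qed
  then show thesis using that by blast
qed

text \<open>A converse to Weyl's inequality with polynomial losses in \<open>Q\<close> and none in \<open>X\<close>; the absence of
  factors such as \<open>log X\<close> is what makes the moment estimate below sharp up to a constant.
  The condition \<open>2 \<le> Q\<close> lets powers of \<open>Q\<close> absorb all numerical constants.\<close>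

lemma weyl_inverse:
  assumes "d \<ge> 1"
  shows "\<exists>C. \<forall>\<gamma> f X Q m l. diff_lead d \<gamma> f \<longrightarrow> 1 \<le> X \<longrightarrow> 2 \<le> Q \<longrightarrow> l \<le> X \<longrightarrow>
      real X / Q \<le> norm (\<Sum>i<l. expi2 (f (m + int i))) \<longrightarrow>
      (\<exists>(q::nat) (z::int). 1 \<le> q \<and> real q \<le> Q ^ C \<and> \<bar>real q * \<gamma> - of_int z\<bar> * real X ^ d \<le> Q ^ C)"
  using assms
proof (induction d rule: dec_induct)
  case base
  show ?case
  proof (rule exI[of _ "1::nat"], intro allI impI)
    fix \<gamma> Q :: real and f :: "int \<Rightarrow> real" and X l :: nat and m :: int
    assume f: "diff_lead 1 \<gamma> f" and X: "1 \<le> X" and Q: "2 \<le> Q" and "l \<le> X"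
      and S: "real X / Q \<le> norm (\<Sum>i<l. expi2 (f (m + int i)))"
    have "f (m + int i) = f m + real i * \<gamma>" for i
    proof -
      have "f (m + int i) - f m = \<gamma> * of_int (int i)" using f by simp
      then show ?thesis by (simp add: mult.commute)
    qed
    then have "2 * \<bar>\<gamma> - of_int (round \<gamma>)\<bar> * norm (\<Sum>i<l. expi2 (f (m + int i))) \<le> 2"
      using geometric_expi2_bound[of \<gamma> "f m" l] by simp
    moreover have "2 * \<bar>\<gamma> - of_int (round \<gamma>)\<bar> * (real X / Q)
        \<le> 2 * \<bar>\<gamma> - of_int (round \<gamma>)\<bar> * norm (\<Sum>i<l. expi2 (f (m + int i)))"
      using S by (intro mult_left_mono) auto
    ultimately have "2 * \<bar>\<gamma> - of_int (round \<gamma>)\<bar> * (real X / Q) \<le> 2" by (rule order_trans[rotated])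
    then have "\<bar>\<gamma> - of_int (round \<gamma>)\<bar> * real X \<le> Q" using Q by (simp add: field_simps)
    then show "\<exists>(q::nat) (z::int). 1 \<le> q \<and> real q \<le> Q ^ 1 \<and> \<bar>real q * \<gamma> - of_int z\<bar> * real X ^ 1 \<le> Q ^ 1"
      using Q by (intro exI[of _ 1] exI[of _ "round \<gamma>"]) auto
  qed
next
  case (step d)
  then obtain C where C: "\<And>\<gamma> f X Q m l. diff_lead d \<gamma> f \<Longrightarrow> 1 \<le> X \<Longrightarrow> 2 \<le> Q \<Longrightarrow> l \<le> X \<Longrightarrow>
      real X / Q \<le> norm (\<Sum>i<l. expi2 (f (m + int i))) \<Longrightarrow>
      \<exists>(q::nat) (z::int). 1 \<le> q \<and> real q \<le> Q ^ C \<and> \<bar>real q * \<gamma> - of_int z\<bar> * real X ^ d \<le> Q ^ C"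
    by metis
  define C' where "C' = (10 * C + 9) * Suc d + 15 * C + 11"
  show ?case
  proof (rule exI[of _ C'], intro allI impI)
    fix \<gamma> Q :: real and f :: "int \<Rightarrow> real" and X l :: nat and m :: int
    assume f: "diff_lead (Suc d) \<gamma> f" and X: "1 \<le> X" and Q: "2 \<le> Q" and l: "l \<le> X"
      and S: "real X / Q \<le> norm (\<Sum>i<l. expi2 (f (m + int i)))"
    have Qmono: "Q ^ i \<le> Q ^ j" if "i \<le> j" for i j using Q that by (intro power_increasing) auto
    have Qnum: "2 ^ j \<le> Q ^ j" for j using Q by (intro power_mono) auto
    \<comment> \<open>If \<open>X\<close> is polynomially bounded in \<open>Q\<close>, then \<open>q = 1\<close> will do; otherwise \<open>X\<close> dominates all
        losses below.\<close>
    show "\<exists>(q::nat) (z::int). 1 \<le> q \<and> real q \<le> Q ^ C' \<and> \<bar>real q * \<gamma> - of_int z\<bar> * real X ^ Suc d \<le> Q ^ C'"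
    proof (cases "real X < Q ^ (10 * C + 9)")
      case True
      have "\<bar>\<gamma> - of_int (round \<gamma>)\<bar> \<le> 1"
        using of_int_round_abs_le[of \<gamma>] by (simp add: abs_minus_commute)
      then have "\<bar>\<gamma> - of_int (round \<gamma>)\<bar> * real X ^ Suc d \<le> 1 * (Q ^ (10 * C + 9)) ^ Suc d"
        using True by (intro mult_mono power_mono) auto
      also have "\<dots> \<le> Q ^ C'" unfolding C'_def by (simp only: mult_1 power_mult[symmetric]) (intro Qmono, simp)
      finally show ?thesis using Q by (intro exI[of _ 1] exI[of _ "round \<gamma>"]) auto
    next
      case False
      then have big: "Q ^ (10 * C + 9) \<le> real X" by simp
      define g where "g i = expi2 (f (m + int i))" for i
      define T where "T h = norm (\<Sum>j<l - h. g (j + h) * cnj (g j))" for h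
      define H where "H = {h \<in> {1..<l}. real X / (8 * Q\<^sup>2) \<le> T h}"
      have T_le: "T h \<le> real X" for h
      proof -
        have "T h \<le> (\<Sum>j<l - h. norm (g (j + h) * cnj (g j)))" unfolding T_def by (rule norm_sum)
        also have "\<dots> = real (l - h)" by (simp add: g_def norm_mult)
        finally show ?thesis using l by linarith
      qed
      have H: "H \<subseteq> {1..X}" "finite H" unfolding H_def using l by auto
      \<comment> \<open>If few \<open>h\<close> had large correlation, the van der Corput bound would be too small.\<close>
      have cardH: "real X / (4 * Q\<^sup>2) \<le> real (card H)"
      proof -
        have "(\<Sum>h\<in>{1..<l}. T h) \<le> (\<Sum>h\<in>{1..<l}. (if h \<in> H then real X else 0) + real X / (8 * Q\<^sup>2))"
        proof (rule sum_mono)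
          fix h assume h: "h \<in> {1..<l}"
          have "0 \<le> real X / (8 * Q\<^sup>2)" by simp
          then show "T h \<le> (if h \<in> H then real X else 0) + real X / (8 * Q\<^sup>2)"
            using add_mono[OF T_le[of h], of 0] h by (cases "h \<in> H") (simp_all add: H_def)
        qed
        also have "\<dots> = real (card H) * real X + real (l - 1) * (real X / (8 * Q\<^sup>2))"
        proof -
          have "{1..<l} \<inter> H = H" unfolding H_def by auto
          then show ?thesis by (simp add: sum.distrib sum.If_cases)
        qed
        also have "real (l - 1) * (real X / (8 * Q\<^sup>2)) \<le> real X * (real X / (8 * Q\<^sup>2))"
          using l by (intro mult_right_mono) auto
        finally have s: "(\<Sum>h\<in>{1..<l}. T h) \<le> real (card H) * real X + real X * (real X / (8 * Q\<^sup>2))" by simp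
        have "(real X / Q)\<^sup>2 \<le> (norm (\<Sum>i<l. g i))\<^sup>2"
          using S Q unfolding g_def by (intro power_mono) auto
        also have "\<dots> \<le> real l + 2 * (\<Sum>h\<in>{1..<l}. T h)"
          unfolding T_def by (rule van_der_corput) (simp add: g_def)
        also have "\<dots> \<le> real X + 2 * (real (card H) * real X + real X * (real X / (8 * Q\<^sup>2)))"
          using l by (intro add_mono mult_left_mono s) auto
        finally have "real X * (real X / Q\<^sup>2) \<le> real X * (1 + 2 * real (card H) + real X / (4 * Q\<^sup>2))"
          by (simp add: power_divide power2_eq_square algebra_simps)
        then have main: "real X / Q\<^sup>2 \<le> 1 + 2 * real (card H) + real X / (4 * Q\<^sup>2)"
          using X by (subst (asm) mult_le_cancel_left_pos) auto
        have "4 * Q\<^sup>2 \<le> Q ^ (10 * C + 9)"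
        proof -
          have "4 * Q\<^sup>2 \<le> Q ^ 2 * Q\<^sup>2" using Qnum[of 2] by (intro mult_right_mono) auto
          also have "\<dots> \<le> Q ^ (10 * C + 9)" unfolding power_add[symmetric] by (intro Qmono) simp
          finally show ?thesis .
        qed
        then have "4 * Q\<^sup>2 \<le> real X" using big by linarith
        then have "1 \<le> real X / (4 * Q\<^sup>2)" using Q by (simp add: field_simps)
        moreover have "real X / Q\<^sup>2 = 4 * (real X / (4 * Q\<^sup>2))" by simp
        ultimately show ?thesis using main by linarith
      qed
      define P where "P = Q ^ (5 * C)"
      have P: "1 \<le> P" unfolding P_def using Q by simp
      have "\<exists>(q::nat) (z::int). 1 \<le> q \<and> real q \<le> P \<and> \<bar>real q * (\<gamma> * real h) - of_int z\<bar> * real X ^ d \<le> P"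
        if h: "h \<in> H" for h
      proof -
        have "8 * Q\<^sup>2 \<le> Q ^ 3 * Q\<^sup>2" using Qnum[of 3] by (intro mult_right_mono) auto
        then have Q5: "8 * Q\<^sup>2 \<le> Q ^ 5" by (simp add: power_add[symmetric])
        have le: "(8 * Q\<^sup>2) ^ C \<le> P"
          unfolding P_def power_mult using Q5 by (intro power_mono) auto
        have lead: "diff_lead d (\<gamma> * real h) (\<lambda>x. f (x + int h) - f x)"
          using f by (metis diff_lead.simps(2) of_int_of_nat_eq)
        have "g (j + h) * cnj (g j) = expi2 (f (m + int j + int h) - f (m + int j))" for j
          unfolding g_def expi2_diff by (simp add: add.assoc)
        then have "real X / (8 * Q\<^sup>2) \<le> norm (\<Sum>j<l - h. expi2 (f (m + int j + int h) - f (m + int j)))"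
          using h unfolding H_def T_def by simp
        moreover have "2 \<le> 8 * Q\<^sup>2" using Qnum[of 2] by simp
        ultimately have "\<exists>(q::nat) (z::int). 1 \<le> q \<and> real q \<le> (8 * Q\<^sup>2) ^ C \<and>
            \<bar>real q * (\<gamma> * real h) - of_int z\<bar> * real X ^ d \<le> (8 * Q\<^sup>2) ^ C"
          using l by (intro C[OF lead X, where l = "l - h" and m = m]) auto
        then obtain q :: nat and z :: int where qz: "1 \<le> q" "real q \<le> (8 * Q\<^sup>2) ^ C"
          "\<bar>real q * (\<gamma> * real h) - of_int z\<bar> * real X ^ d \<le> (8 * Q\<^sup>2) ^ C"
          by blast
        show ?thesis by (rule exI[of _ q], rule exI[of _ z]) (use qz le in auto)
      qed
      then obtain qf where qf: "\<And>h. h \<in> H \<Longrightarrow> 1 \<le> qf h \<and> real (qf h) \<le> P \<and>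
          (\<exists>z::int. \<bar>real (qf h) * (\<gamma> * real h) - of_int z\<bar> * real X ^ d \<le> P)" by metis
      have "0 < real X / (4 * Q\<^sup>2)" using X Q by simp
      then have "H \<noteq> {}" using cardH by auto
      \<comment> \<open>The denominators found for different \<open>h\<close> take at most \<open>P\<close> values; the most frequent one is
          used for all \<open>h\<close> at once.\<close>
      then obtain q0 where q0: "q0 \<in> qf ` H" "real (card H) \<le> P * real (card {h \<in> H. qf h = q0})"
        using pigeonhole_fibre[OF H(2), of qf P] qf by blast
      define H' where "H' = {h \<in> H. qf h = q0}"
      define \<eta> where "\<eta> = 1 / (4 * Q\<^sup>2 * P)"
      define \<epsilon> where "\<epsilon> = P / real X ^ d"
      have \<eta>: "0 < \<eta>" unfolding \<eta>_def using Q P by simp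
      have X0: "0 < real X ^ d" using X by simp
      have cardH': "\<eta> * real X \<le> real (card H')"
      proof -
        have "real X / (4 * Q\<^sup>2) \<le> P * real (card H')" using cardH q0(2) unfolding H'_def by linarith
        then show ?thesis unfolding \<eta>_def using Q P by (simp add: field_simps)
      qed
      have near: "\<exists>z::int. \<bar>real q0 * \<gamma> * real h - of_int z\<bar> \<le> \<epsilon>" if "h \<in> H'" for h
        using qf[of h] that X0 unfolding H'_def \<epsilon>_def by (auto simp: pos_le_divide_eq mult.assoc)
      have small: "24 * \<epsilon> \<le> \<eta>"
      proof -
        have "96 \<le> Q ^ 7" using Qnum[of 7] by simp
        then have "96 * (Q\<^sup>2 * P * P) \<le> Q ^ 7 * (Q\<^sup>2 * P * P)" using P Q by (intro mult_right_mono) auto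
        also have "\<dots> = Q ^ (10 * C + 9)" unfolding P_def power_add[symmetric] by (rule arg_cong[where f = "(^) Q"]) simp
        also have "\<dots> \<le> real X" by (rule big)
        also have "\<dots> \<le> real X ^ d" using X step.hyps by (intro self_le_power) auto
        finally show ?thesis unfolding \<epsilon>_def \<eta>_def using P Q X0 by (simp add: field_simps)
      qed
      obtain q1 :: nat and z :: int where q1: "1 \<le> q1" "\<eta> * real q1 \<le> 8"
        "\<bar>real q1 * (real q0 * \<gamma>) - of_int z\<bar> * (\<eta> * real X) \<le> real q1 * \<epsilon>"
        using vinogradov_lemma[OF X \<eta> _ cardH' near small] H(1) unfolding H'_def by blast
      have q1le: "real q1 \<le> Q ^ (5 * C + 7)"
      proof -
        have "real q1 \<le> 32 * (Q\<^sup>2 * P)" using q1(2) P Q unfolding \<eta>_def by (simp add: field_simps)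
        also have "\<dots> \<le> Q ^ 5 * (Q\<^sup>2 * P)" using Qnum[of 5] P Q by (intro mult_right_mono) auto
        also have "\<dots> = Q ^ (5 * C + 7)" unfolding P_def power_add[symmetric] by (rule arg_cong[where f = "(^) Q"]) simp
        finally show ?thesis .
      qed
      have "real (q1 * q0) \<le> Q ^ (5 * C + 7) * P"
        using q1le q0(1) qf Q by (auto intro!: mult_mono)
      also have "\<dots> = Q ^ (10 * C + 7)" unfolding P_def power_add[symmetric] by (rule arg_cong[where f = "(^) Q"]) simp
      also have "\<dots> \<le> Q ^ C'" by (rule Qmono) (simp add: C'_def)
      finally have qle: "real (q1 * q0) \<le> Q ^ C'" .
      have "\<bar>real q1 * (real q0 * \<gamma>) - of_int z\<bar> * real X ^ Suc d \<le> real q1 * (4 * Q\<^sup>2 * P * P)"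
        using q1(3) P Q X0 unfolding \<eta>_def \<epsilon>_def by (simp add: field_simps)
      also have "\<dots> \<le> Q ^ (5 * C + 7) * (Q ^ 2 * Q\<^sup>2 * P * P)"
        using q1le Qnum[of 2] P Q by (intro mult_mono) auto
      also have "\<dots> = Q ^ (15 * C + 11)" unfolding P_def power_add[symmetric] by (rule arg_cong[where f = "(^) Q"]) simp
      also have "\<dots> \<le> Q ^ C'" by (rule Qmono) (simp add: C'_def)
      finally have "\<bar>real (q1 * q0) * \<gamma> - of_int z\<bar> * real X ^ Suc d \<le> Q ^ C'" by (simp add: mult.assoc)
      moreover have "1 \<le> q1 * q0" using q1(1) q0(1) qf by auto
      ultimately show ?thesis using qle by blast
    qed
  qed
qed

section \<open>Representations as sums of powers\<close>

text \<open>The frequencies are the multiples of \<open>1 / X\<^sup>k\<close>, so that representations are counted modulo \<open>X\<^sup>k\<close>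
  by a finite Fourier sum. Reducing modulo \<open>X\<^sup>k\<close> can only increase the count.\<close>

definition weyl_sum :: "nat \<Rightarrow> nat \<Rightarrow> nat \<Rightarrow> complex" where
  "weyl_sum k X a = (\<Sum>x<X. expi2 (real a * real ((1 + x) ^ k) / real (X ^ k)))"

text \<open>A large value at \<open>a\<close> gives \<open>p a = r + z M\<close> with \<open>M = X\<^sup>k\<close> and with \<open>p\<close>, \<open>z\<close>, \<open>r\<close> polynomially bounded
  in \<open>j\<close>. Since \<open>(p, z, r)\<close> determines \<open>a\<close>, it suffices to count these triples.\<close>

lemma weyl_sum_large_values:
  assumes "k \<ge> 1"
  shows "\<exists>C K. K \<ge> 1 \<and> (\<forall>X\<ge>1. \<forall>j\<ge>2.
    card {a \<in> {..<X ^ k}. real X / real j \<le> norm (weyl_sum k X a)} \<le> K * j ^ (3 * C))"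
proof -
  obtain C where C: "\<And>\<gamma> f X Q m l. diff_lead k \<gamma> f \<Longrightarrow> 1 \<le> X \<Longrightarrow> 2 \<le> Q \<Longrightarrow> l \<le> X \<Longrightarrow>
      real X / Q \<le> norm (\<Sum>i<l. expi2 (f (m + int i))) \<Longrightarrow>
      \<exists>(q::nat) (z::int). 1 \<le> q \<and> real q \<le> Q ^ C \<and> \<bar>real q * \<gamma> - of_int z\<bar> * real X ^ k \<le> Q ^ C"
    using weyl_inverse[OF assms] by metis
  show ?thesis
  proof (rule exI[of _ C], rule exI[of _ "15 * fact k ^ 3"], intro conjI allI impI)
    fix X j :: nat assume X: "X \<ge> 1" and j: "j \<ge> 2"
    define M where "M = X ^ k"
    define B where "B = fact k * j ^ C"
    have M: "M \<ge> 1" unfolding M_def using X by simp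
    have B: "B \<ge> 1" "j ^ C \<le> B" unfolding B_def using j by auto
    define Box where "Box = {1..int B} \<times> {- (2 * int B)..2 * int B} \<times> {- int B..int B}"
    define dec where "dec = (\<lambda>(p, z, r). nat ((r + z * int M) div p))"
    have "a \<in> dec ` Box" if a: "a < M" "real X / real j \<le> norm (weyl_sum k X a)" for a
    proof -
      define \<alpha> where "\<alpha> = real a / real M"
      have "real X / real j \<le> norm (\<Sum>i<X. expi2 (\<alpha> * of_int (1 + int i) ^ k))"
        using a(2) unfolding weyl_sum_def \<alpha>_def M_def by (simp add: mult.commute)
      then obtain q :: nat and z :: int where q: "1 \<le> q" "real q \<le> real j ^ C"
        and z: "\<bar>real q * (fact k * \<alpha>) - of_int z\<bar> * real X ^ k \<le> real j ^ C"
        using C[OF diff_lead_power X, of "real j" X \<alpha> 1] j by auto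
      define p where "p = int (q * fact k)"
      define r where "r = p * int a - z * int M"
      have "of_int r = (real q * (fact k * \<alpha>) - of_int z) * real M"
        unfolding r_def p_def \<alpha>_def using M by (simp add: field_simps)
      then have "\<bar>of_int r\<bar> \<le> real j ^ C" using z by (simp add: abs_mult M_def)
      then have "of_int \<bar>r\<bar> \<le> (of_int (int (j ^ C)) :: real)" by simp
      then have "\<bar>r\<bar> \<le> int (j ^ C)" by (simp only: of_int_le_iff)
      then have r: "\<bar>r\<bar> \<le> int B" using B(2) by linarith
      have "q \<le> j ^ C" using q(2) by (metis of_nat_le_iff of_nat_power)
      then have "q * fact k \<le> B" unfolding B_def by simp
      then have p: "1 \<le> p" "p \<le> int B" using q(1) unfolding p_def by (auto simp del: of_nat_mult)
      have "\<bar>z\<bar> * int M = \<bar>p * int a - r\<bar>" unfolding r_def by (simp add: abs_mult)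
      also have "\<dots> \<le> \<bar>p * int a\<bar> + \<bar>r\<bar>" by (rule abs_triangle_ineq4)
      also have "\<dots> \<le> p * int a + int B" using r p by simp
      also have "\<dots> \<le> int B * int M + int B * int M"
        using p a M by (intro add_mono mult_mono) auto
      finally have "\<bar>z\<bar> * int M \<le> (2 * int B) * int M" by simp
      then have "\<bar>z\<bar> \<le> 2 * int B" using M by simp
      then have "(p, z, r) \<in> Box" unfolding Box_def using p r by auto
      moreover have "a = dec (p, z, r)" unfolding dec_def r_def using p by simp
      ultimately show ?thesis by blast
    qed
    then have "{a \<in> {..<M}. real X / real j \<le> norm (weyl_sum k X a)} \<subseteq> dec ` Box" by auto
    moreover have finBox: "finite Box" unfolding Box_def by simp
    ultimately have "card {a \<in> {..<M}. real X / real j \<le> norm (weyl_sum k X a)} \<le> card Box"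
      by (meson card_image_le card_mono finite_imageI order_trans)
    also have "card Box = B * ((4 * B + 1) * (2 * B + 1))"
      unfolding Box_def by (simp add: card_cartesian_product nat_add_distrib nat_mult_distrib)
    also have "\<dots> \<le> B * ((5 * B) * (3 * B))" using B(1) by (intro mult_mono) auto
    also have "\<dots> = 15 * fact k ^ 3 * j ^ (3 * C)"
      unfolding B_def by (simp add: power3_eq_cube power_mult power_mult_distrib mult_ac power_commutes)
    finally show "card {a \<in> {..<X ^ k}. real X / real j \<le> norm (weyl_sum k X a)} \<le> 15 * fact k ^ 3 * j ^ (3 * C)"
      unfolding M_def .
  qed simp
qed

lemma sum_inverse_squares_le:
  assumes "finite Y" "Y \<subseteq> {2..}"
  shows "(\<Sum>y\<in>Y. 1 / (real y)\<^sup>2) \<le> 1"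
proof -
  have *: "(\<Sum>y\<in>{2..n}. 1 / (real y)\<^sup>2) \<le> 1 - 1 / real n" if "n \<ge> 1" for n :: nat
    using that
  proof (induction n rule: dec_induct)
    case (step n)
    have "(\<Sum>y\<in>{2..Suc n}. 1 / (real y)\<^sup>2) = (\<Sum>y\<in>{2..n}. 1 / (real y)\<^sup>2) + 1 / (real (Suc n))\<^sup>2"
      using step by (subst atLeastAtMostSuc_conv) auto
    also have "\<dots> \<le> 1 - 1 / real n + 1 / (real n * real (Suc n))"
      using step by (intro add_mono frac_le) (auto simp: power2_eq_square)
    also have "\<dots> = 1 - 1 / real (Suc n)"
    proof -
      have "1 / (real n * real (Suc n)) = 1 / real n - 1 / real (Suc n)"
        using step.hyps by (subst diff_frac_eq) auto
      then show ?thesis by simp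
    qed
    finally show ?case .
  qed simp
  obtain n where n: "n \<ge> 1" "Y \<subseteq> {2..n}"
  proof (rule that[of "Suc (Max Y)"])
    show "Y \<subseteq> {2..Suc (Max Y)}" using assms Max_ge[of Y] by (force intro: le_SucI)
  qed simp
  have "(\<Sum>y\<in>Y. 1 / (real y)\<^sup>2) \<le> (\<Sum>y\<in>{2..n}. 1 / (real y)\<^sup>2)"
    using n by (intro sum_mono2) auto
  also have "\<dots> \<le> 1" by (rule order_trans[OF *[OF n(1)]]) simp
  finally show ?thesis .
qed

text \<open>Group the frequencies by the integer \<open>j\<close> for which the sum has size about \<open>X / j\<close>. At most
  \<open>K * j ^ (3 * C)\<close> of them contribute about \<open>(X / j) ^ s\<close> each, and the choice \<open>s = 3 * C + 2\<close> leaves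
  the convergent sum of inverse squares.\<close>

lemma weyl_sum_moment:
  assumes "k \<ge> 1"
  shows "\<exists>s\<ge>1. \<exists>K>0. \<forall>X\<ge>1. (\<Sum>a<X ^ k. norm (weyl_sum k X a) ^ s) \<le> K * real X ^ s"
proof -
  obtain C K :: nat where K: "K \<ge> 1" and CK: "\<And>X j. X \<ge> 1 \<Longrightarrow> j \<ge> 2 \<Longrightarrow>
    card {a \<in> {..<X ^ k}. real X / real j \<le> norm (weyl_sum k X a)} \<le> K * j ^ (3 * C)"
    using weyl_sum_large_values[OF assms] by metis
  define s where "s = 3 * C + 2"
  show ?thesis
  proof (rule exI[of _ s], intro conjI, simp add: s_def, rule exI[of _ "3 ^ s * real K"], intro conjI allI impI)
    fix X :: nat assume X: "X \<ge> 1"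
    define t where "t a = norm (weyl_sum k X a)" for a
    have t_le: "t a \<le> real X" for a
    proof -
      have "t a \<le> (\<Sum>x<X. norm (expi2 (real a * real ((1 + x) ^ k) / real (X ^ k))))"
        unfolding t_def weyl_sum_def by (rule norm_sum)
      then show ?thesis by simp
    qed
    define S where "S = {a \<in> {..<X ^ k}. t a \<noteq> 0}"
    \<comment> \<open>The extra \<open>1\<close> ensures \<open>J a \<ge> 2\<close>, the range of the level set estimate.\<close>
    define J where "J a = nat \<lceil>real X / t a\<rceil> + 1" for a
    have J: "2 \<le> J a" "real X / real (J a) \<le> t a" "t a \<le> 3 * real X / real (J a)" if "a \<in> S" for a
    proof -
      have t0: "0 < t a" using that unfolding S_def t_def by auto
      define u where "u = real X / t a"
      have u1: "1 \<le> u" unfolding u_def using t0 t_le by simp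
      then have Ju: "real (J a) = of_int \<lceil>u\<rceil> + 1" unfolding J_def u_def[symmetric] by simp
      have "u \<le> of_int \<lceil>u\<rceil>" "of_int \<lceil>u\<rceil> < u + 1" by linarith+
      then have b: "u \<le> real (J a)" "real (J a) \<le> 3 * u" "2 \<le> real (J a)" using Ju u1 by linarith+
      show "2 \<le> J a" using b(3) by simp
      have "0 < real (J a)" using b(3) by linarith
      then show "real X / real (J a) \<le> t a" "t a \<le> 3 * real X / real (J a)"
        using b(1,2) t0 unfolding u_def by (simp_all add: field_simps)
    qed
    have finS: "finite S" unfolding S_def by simp
    have "(\<Sum>a<X ^ k. t a ^ s) = (\<Sum>a\<in>S. t a ^ s)"
      unfolding S_def by (rule sum.mono_neutral_right) (auto simp: s_def)
    also have "\<dots> \<le> (\<Sum>a\<in>S. (3 * real X / real (J a)) ^ s)"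
      using J by (intro sum_mono power_mono) (auto simp: t_def)
    also have "\<dots> = (\<Sum>j\<in>J ` S. \<Sum>a\<in>{a \<in> S. J a = j}. (3 * real X / real (J a)) ^ s)"
      by (rule sum.image_gen[OF finS])
    also have "\<dots> = (\<Sum>j\<in>J ` S. real (card {a \<in> S. J a = j}) * (3 * real X / real j) ^ s)"
      by (intro sum.cong refl) simp
    also have "\<dots> \<le> (\<Sum>j\<in>J ` S. (3 ^ s * real K * real X ^ s) * (1 / (real j)\<^sup>2))"
    proof (rule sum_mono)
      fix j assume "j \<in> J ` S"
      then have j: "2 \<le> j" using J by auto
      have "card {a \<in> S. J a = j} \<le> card {a \<in> {..<X ^ k}. real X / real j \<le> norm (weyl_sum k X a)}"
        using J(2) unfolding S_def t_def by (intro card_mono) auto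
      also have "\<dots> \<le> K * j ^ (3 * C)" by (rule CK[OF X j])
      finally have "real (card {a \<in> S. J a = j}) \<le> real (K * j ^ (3 * C))" by (rule of_nat_mono)
      then have "real (card {a \<in> S. J a = j}) * (3 * real X / real j) ^ s
          \<le> real (K * j ^ (3 * C)) * (3 * real X / real j) ^ s"
        by (intro mult_right_mono) auto
      also have "\<dots> = (3 ^ s * real K * real X ^ s) * (1 / (real j)\<^sup>2)"
        unfolding s_def using j by (simp add: power_divide power_mult_distrib power_add power2_eq_square)
      finally show "real (card {a \<in> S. J a = j}) * (3 * real X / real j) ^ s
          \<le> (3 ^ s * real K * real X ^ s) * (1 / (real j)\<^sup>2)" .
    qed
    also have "\<dots> = (3 ^ s * real K * real X ^ s) * (\<Sum>j\<in>J ` S. 1 / (real j)\<^sup>2)"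
      by (simp only: sum_distrib_left)
    also have "\<dots> \<le> (3 ^ s * real K * real X ^ s) * 1"
      using finS J by (intro mult_left_mono sum_inverse_squares_le) auto
    finally show "(\<Sum>a<X ^ k. norm (weyl_sum k X a) ^ s) \<le> 3 ^ s * real K * real X ^ s"
      unfolding t_def by simp
  qed (use K in simp)
qed

lemma expi2_sum: "expi2 (\<Sum>i\<in>I. f i) = (\<Prod>i\<in>I. expi2 (f i))"
proof (induction I rule: infinite_finite_induct)
  case (insert i I)
  then show ?case by (simp add: expi2_add)
qed (auto simp: expi2_def)

lemma expi2_orthogonality:
  assumes M: "M \<ge> 1"
  shows "(\<Sum>a<M. expi2 (real a * of_int t / real M)) = (if int M dvd t then of_nat M else 0)"
proof -
  define z where "z = expi2 (of_int t / real M)"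
  have pw: "expi2 (real a * of_int t / real M) = z ^ a" for a
    unfolding z_def expi2_def Complex.DeMoivre by (simp add: mult_ac)
  show ?thesis
  proof (cases "int M dvd t")
    case True
    then obtain v where "t = int M * v" by blast
    then have "z = 1" unfolding z_def using M by simp
    then show ?thesis unfolding pw using True by simp
  next
    case False
    have "z \<noteq> 1"
    proof
      assume "z = 1"
      then have "cos (2 * pi * (of_int t / real M)) = 1"
        unfolding z_def expi2_def by (metis cis.simps(1) one_complex.simps(1))
      then obtain v :: int where "2 * pi * (of_int t / real M) = of_int v * 2 * pi"
        using cos_one_2pi_int by blast
      then have "2 * pi * (of_int t / real M) = 2 * pi * of_int v" by (simp only: mult_ac)
      then have "of_int t / real M = of_int v" by (subst (asm) mult_left_cancel) auto
      then have "(of_int t :: real) = of_int (v * int M)" using M by (simp add: field_simps)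
      then have "t = v * int M" by (simp only: of_int_eq_iff)
      then show False using False by simp
    qed
    moreover have "z ^ M = 1"
      using pw[of M, symmetric] M by simp
    then have "(1 - z) * (\<Sum>a<M. z ^ a) = 0" using one_diff_power_eq[of z M] by simp
    ultimately show ?thesis unfolding pw using False by simp
  qed
qed

text \<open>By orthogonality the sum of \<open>weyl_sum k X a ^ s\<close> against a character counts the tuples whose
  value is congruent to \<open>n\<close>; the triangle inequality removes the character.\<close>

lemma representations_le_moment:
  assumes X: "X \<ge> 1"
  shows "real (card {x \<in> {..<s} \<rightarrow>\<^sub>E {..<X}. (\<Sum>i<s. (1 + x i) ^ k) = n}) * real X ^ k
    \<le> (\<Sum>a<X ^ k. norm (weyl_sum k X a) ^ s)"
proof -
  define M where "M = X ^ k"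
  have M: "M \<ge> 1" unfolding M_def using X by simp
  define P where "P = {..<s} \<rightarrow>\<^sub>E {..<X}"
  have finP: "finite P" unfolding P_def by (intro finite_PiE) auto
  define v where "v x = (\<Sum>i<s. (1 + x i) ^ k)" for x :: "nat \<Rightarrow> nat"
  have pow: "weyl_sum k X a ^ s = (\<Sum>x\<in>P. expi2 (real a * real (v x) / real M))" for a
  proof -
    have "weyl_sum k X a ^ s = (\<Prod>i<s. \<Sum>y<X. expi2 (real a * real ((1 + y) ^ k) / real M))"
      unfolding weyl_sum_def M_def by simp
    also have "\<dots> = (\<Sum>x\<in>P. \<Prod>i<s. expi2 (real a * real ((1 + x i) ^ k) / real M))"
      unfolding P_def by (subst prod_sum_PiE) auto
    also have "\<dots> = (\<Sum>x\<in>P. expi2 (real a * real (v x) / real M))"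
      unfolding expi2_sum[symmetric] v_def by (simp add: sum_distrib_left sum_divide_distrib)
    finally show ?thesis .
  qed
  have "(\<Sum>a<M. weyl_sum k X a ^ s * expi2 (- (real a * real n / real M)))
      = (\<Sum>a<M. \<Sum>x\<in>P. expi2 (real a * of_int (int (v x) - int n) / real M))"
  proof (intro sum.cong refl)
    fix a
    have "expi2 (real a * real (v x) / real M) * expi2 (- (real a * real n / real M))
        = expi2 (real a * of_int (int (v x) - int n) / real M)" for x
      unfolding expi2_add[symmetric] by (simp add: algebra_simps diff_divide_distrib)
    then show "weyl_sum k X a ^ s * expi2 (- (real a * real n / real M))
        = (\<Sum>x\<in>P. expi2 (real a * of_int (int (v x) - int n) / real M))"
      unfolding pow sum_distrib_right by simp
  qed
  also have "\<dots> = (\<Sum>x\<in>P. if int M dvd int (v x) - int n then of_nat M else 0)"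
    by (subst sum.swap) (simp only: expi2_orthogonality[OF M])
  also have "\<dots> = of_nat (card {x \<in> P. int M dvd int (v x) - int n} * M)"
    using finP by (simp add: sum.If_cases Int_def)
  finally have eq: "(\<Sum>a<M. weyl_sum k X a ^ s * expi2 (- (real a * real n / real M)))
      = of_nat (card {x \<in> P. int M dvd int (v x) - int n} * M)" .
  have "card {x \<in> P. v x = n} \<le> card {x \<in> P. int M dvd int (v x) - int n}"
    using finP by (intro card_mono) auto
  then have "real (card {x \<in> P. v x = n}) * real M \<le> real (card {x \<in> P. int M dvd int (v x) - int n} * M)"
    by (simp add: mult_right_mono)
  also have "\<dots> = norm (\<Sum>a<M. weyl_sum k X a ^ s * expi2 (- (real a * real n / real M)))"
    unfolding eq by (simp only: norm_of_nat)
  also have "\<dots> \<le> (\<Sum>a<M. norm (weyl_sum k X a ^ s * expi2 (- (real a * real n / real M))))"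
    by (rule norm_sum)
  also have "\<dots> = (\<Sum>a<M. norm (weyl_sum k X a) ^ s)" by (simp add: norm_mult norm_power)
  finally show ?thesis unfolding M_def P_def v_def by simp
qed

text \<open>Double counting of the tuples with entries in \<open>A\<close>: there are at least \<open>(\<delta> X)\<^sup>s\<close> of them, and each
  value is taken at most \<open>K X\<^sup>s / X\<^sup>k\<close> times.\<close>

lemma sumset_powers_density:
  fixes \<delta> K :: real
  assumes k: "k \<ge> 1" and s: "s \<ge> 1" and \<delta>: "0 < \<delta>" and K: "0 < K"
    and rep: "\<And>X n. X \<ge> 1 \<Longrightarrow>
      real (card {x \<in> {..<s} \<rightarrow>\<^sub>E {..<X}. (\<Sum>i<s. (1 + x i) ^ k) = n}) * real X ^ k \<le> K * real X ^ s"
    and dens: "\<And>X. X \<ge> X0 \<Longrightarrow> \<delta> * real X \<le> real (card {x \<in> {..<X}. (1 + x) ^ k \<in> A})"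
    and N: "N \<ge> s * (Suc X0) ^ k"
  shows "\<delta> ^ s / (K * real s * 2 ^ k) * real N \<le> real (card (sumset s A \<inter> {1..N}))"
proof -
  \<comment> \<open>\<open>Y - 1\<close> is the largest \<open>X\<close> for which all sums of \<open>s\<close> powers of numbers up to \<open>X\<close> are at most \<open>N\<close>\<close>
  define Y where "Y = (LEAST Y. N < s * Y ^ k)"
  have "N < s * (Suc N) ^ k"
  proof -
    have "Suc N \<le> (Suc N) ^ k" using k by (intro self_le_power) auto
    also have "\<dots> \<le> s * (Suc N) ^ k" using s by simp
    finally show ?thesis by simp
  qed
  then have Y: "N < s * Y ^ k" unfolding Y_def by (rule LeastI)
  have "Y \<noteq> 0"
  proof
    assume "Y = 0"
    then show False using Y k by (simp add: power_0_left)
  qed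
  then obtain X where X: "Y = Suc X" by (cases Y) auto
  have XN: "s * X ^ k \<le> N" using not_less_Least[of X "\<lambda>Y. N < s * Y ^ k"] X unfolding Y_def by simp
  have "Suc X0 < Suc X"
  proof (rule ccontr)
    assume "\<not> ?thesis"
    then have "s * Y ^ k \<le> s * (Suc X0) ^ k" using X by (intro mult_left_mono power_mono) auto
    then show False using Y N by linarith
  qed
  then have X0: "X \<ge> X0" "X \<ge> 1" by auto
  define E where "E = {x \<in> {..<X}. (1 + x) ^ k \<in> A}"
  define P where "P = {..<s} \<rightarrow>\<^sub>E E"
  define v where "v x = (\<Sum>i<s. (1 + x i) ^ k)" for x :: "nat \<Rightarrow> nat"
  have finE: "finite E" unfolding E_def by simp
  have finP: "finite P" unfolding P_def using finE by (intro finite_PiE) auto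
  have "v ` P \<subseteq> sumset s A \<inter> {1..s * X ^ k}"
  proof
    fix n assume "n \<in> v ` P"
    then obtain x where x: "x \<in> P" "n = v x" by blast
    have xE: "x i \<in> E" if "i < s" for i using x(1) that unfolding P_def by auto
    have "n \<in> sumset s A" unfolding sumset_def x(2) v_def using xE unfolding E_def by blast
    moreover have "n \<le> (\<Sum>i<s. X ^ k)" unfolding x(2) v_def
    proof (rule sum_mono)
      fix i assume "i \<in> {..<s}"
      then have "x i < X" using xE unfolding E_def by auto
      then show "(1 + x i) ^ k \<le> X ^ k" by (intro power_mono) auto
    qed
    moreover have "(1 + x 0) ^ k \<le> n" unfolding x(2) v_def using s by (intro member_le_sum) auto
    then have "1 \<le> n" using one_le_power[of "1 + x 0" k] by linarith
    ultimately show "n \<in> sumset s A \<inter> {1..s * X ^ k}" by simp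
  qed
  then have sub: "v ` P \<subseteq> sumset s A \<inter> {1..N}" using XN by auto
  have fibre: "real (card {x \<in> P. v x = n}) * real X ^ k \<le> K * real X ^ s" for n
  proof -
    have "{x \<in> P. v x = n} \<subseteq> {x \<in> {..<s} \<rightarrow>\<^sub>E {..<X}. (\<Sum>i<s. (1 + x i) ^ k) = n}"
      unfolding P_def v_def E_def by (auto simp: PiE_iff)
    then have "card {x \<in> P. v x = n} \<le> card {x \<in> {..<s} \<rightarrow>\<^sub>E {..<X}. (\<Sum>i<s. (1 + x i) ^ k) = n}"
      by (intro card_mono) (auto intro!: finite_PiE)
    then have "real (card {x \<in> P. v x = n}) * real X ^ k
        \<le> real (card {x \<in> {..<s} \<rightarrow>\<^sub>E {..<X}. (\<Sum>i<s. (1 + x i) ^ k) = n}) * real X ^ k"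
      by (intro mult_right_mono) auto
    also have "\<dots> \<le> K * real X ^ s" by (rule rep[OF X0(2)])
    finally show ?thesis .
  qed
  have "card P = card E ^ s" unfolding P_def by (simp add: card_PiE)
  moreover have "(\<delta> * real X) ^ s \<le> real (card E) ^ s"
    using dens[OF X0(1)] \<delta> unfolding E_def by (intro power_mono) auto
  ultimately have "(\<delta> * real X) ^ s \<le> real (card P)" by simp
  also have "card P = (\<Sum>n\<in>v ` P. card {x \<in> P. v x = n})"
    using sum.image_gen[OF finP, of "\<lambda>_. 1::nat" v] by simp
  finally have "(\<delta> * real X) ^ s * real X ^ k \<le> (\<Sum>n\<in>v ` P. real (card {x \<in> P. v x = n}) * real X ^ k)"
    by (simp add: sum_distrib_right[symmetric] mult_right_mono)
  also have "\<dots> \<le> (\<Sum>n\<in>v ` P. K * real X ^ s)" by (intro sum_mono fibre)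
  also have "\<dots> = real (card (v ` P)) * (K * real X ^ s)" by simp
  also have "\<dots> \<le> real (card (sumset s A \<inter> {1..N})) * (K * real X ^ s)"
    using sub K by (intro mult_right_mono of_nat_mono card_mono) auto
  finally have "real X ^ s * (\<delta> ^ s * real X ^ k) \<le> real X ^ s * (K * real (card (sumset s A \<inter> {1..N})))"
    by (simp add: power_mult_distrib mult_ac)
  then have main: "\<delta> ^ s * real X ^ k \<le> K * real (card (sumset s A \<inter> {1..N}))"
    using X0(2) by simp
  have "real N \<le> real s * (2 ^ k * real X ^ k)"
  proof -
    have "N \<le> s * (2 * X) ^ k"
    proof -
      have "s * Y ^ k \<le> s * (2 * X) ^ k" using X X0(2) by (intro mult_left_mono power_mono) auto
      then show ?thesis using Y by linarith
    qed
    then have "real N \<le> real (s * (2 * X) ^ k)" by (rule of_nat_mono)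
    then show ?thesis by (simp add: power_mult_distrib)
  qed
  then have "\<delta> ^ s * real N \<le> \<delta> ^ s * (real s * (2 ^ k * real X ^ k))"
    using \<delta> by (intro mult_left_mono) auto
  also have "\<dots> = real s * 2 ^ k * (\<delta> ^ s * real X ^ k)" by simp
  also have "\<dots> \<le> real s * 2 ^ k * (K * real (card (sumset s A \<inter> {1..N})))"
    using main by (intro mult_left_mono) auto
  finally show ?thesis using K s by (simp add: field_simps)
qed

lemma lower_rel_density_roots:
  assumes k: "k \<ge> 1" and A: "A \<subseteq> kth_powers k" and d: "lower_rel_density k A > ereal \<delta>"
  obtains X0 where "\<And>X. X \<ge> X0 \<Longrightarrow> \<delta> * real X \<le> real (card {x \<in> {..<X}. (1 + x) ^ k \<in> A})"
proof -
  have "\<forall>\<^sub>F N in sequentially. ereal \<delta> < ereal (real (card (A \<inter> {1..N})) / real (card (kth_powers k \<inter> {1..N})))"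
    using d unfolding lower_rel_density_def by (rule less_LiminfD)
  then obtain N0 where N0: "\<And>N. N \<ge> N0 \<Longrightarrow>
      \<delta> < real (card (A \<inter> {1..N})) / real (card (kth_powers k \<inter> {1..N}))"
    unfolding eventually_sequentially by auto
  have inj: "inj_on (\<lambda>x. (1 + x) ^ k) S" for S :: "nat set"
    using k by (auto simp: inj_on_def power_eq_iff_eq_base)
  have range: "B \<inter> {1..X ^ k} = (\<lambda>x. (1 + x) ^ k) ` {x \<in> {..<X}. (1 + x) ^ k \<in> B}"
    if B: "B \<subseteq> kth_powers k" for B and X :: nat
  proof (intro equalityI subsetI)
    fix n assume n: "n \<in> B \<inter> {1..X ^ k}"
    then obtain t where t: "n = t ^ k" "t \<ge> 1" using B unfolding kth_powers_def by blast
    then have "t \<le> X" using n k by (simp add: power_mono_iff)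
    then show "n \<in> (\<lambda>x. (1 + x) ^ k) ` {x \<in> {..<X}. (1 + x) ^ k \<in> B}"
      using t n by (intro image_eqI[of _ _ "t - 1"]) auto
  qed (auto intro!: power_mono simp: Suc_le_eq simp del: One_nat_def)
  show thesis
  proof (rule that[of "Suc N0"])
    fix X assume X: "X \<ge> Suc N0"
    have "X \<le> X ^ k" using X k by (intro self_le_power) auto
    then have "\<delta> < real (card (A \<inter> {1..X ^ k})) / real (card (kth_powers k \<inter> {1..X ^ k}))"
      using X by (intro N0) simp
    moreover have "card (A \<inter> {1..X ^ k}) = card {x \<in> {..<X}. (1 + x) ^ k \<in> A}"
      unfolding range[OF A] by (rule card_image[OF inj])
    moreover have "card (kth_powers k \<inter> {1..X ^ k}) = X"
    proof -
      have "{x \<in> {..<X}. (1 + x) ^ k \<in> kth_powers k} = {..<X}" unfolding kth_powers_def by auto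
      then show ?thesis unfolding range[OF order_refl] by (metis card_image card_lessThan inj)
    qed
    ultimately show "\<delta> * real X \<le> real (card {x \<in> {..<X}. (1 + x) ^ k \<in> A})"
      using X by (simp add: field_simps)
  qed
qed

theorem mainTheorem3:
  fixes k :: nat and \<delta> :: real
  assumes "k \<ge> 2" and "\<delta> > 0"
  shows "\<exists>s\<ge>1. \<forall>A. A \<subseteq> kth_powers k \<longrightarrow>
           \<not> (\<exists>P. nontrivial_arith_prog P \<and> A \<subseteq> P) \<longrightarrow>
           lower_rel_density k A > ereal \<delta> \<longrightarrow>
           (\<forall>\<^sub>F n in sequentially. n \<in> sumset s A)"
proof -
  have k: "k \<ge> 1" using assms(1) by simp
  obtain s :: nat and K :: real where s: "s \<ge> 1" "K > 0"
    and mom: "\<And>X. X \<ge> 1 \<Longrightarrow> (\<Sum>a<X ^ k. norm (weyl_sum k X a) ^ s) \<le> K * real X ^ s"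
    using weyl_sum_moment[OF k] by metis
  define \<beta> where "\<beta> = \<delta> ^ s / (K * real s * 2 ^ k)"
  have "0 < \<beta>" unfolding \<beta>_def using s assms(2) by simp
  then obtain t where t: "t \<ge> 1"
    "\<And>B N0. (\<And>N. N \<ge> N0 \<Longrightarrow> \<beta> * real N \<le> real (card (B \<inter> {1..N}))) \<Longrightarrow> unconfined B \<Longrightarrow>
       \<forall>\<^sub>F n in sequentially. n \<in> sumset t B"
    using positive_density_basis by metis
  show ?thesis
  proof (intro exI[of _ "t * s"] conjI allI impI)
    show "1 \<le> t * s" using t(1) s(1) by simp
  next
    fix A
    assume A: "A \<subseteq> kth_powers k" "\<not> (\<exists>P. nontrivial_arith_prog P \<and> A \<subseteq> P)"
      "lower_rel_density k A > ereal \<delta>"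
    obtain X0 where X0: "\<And>X. X \<ge> X0 \<Longrightarrow> \<delta> * real X \<le> real (card {x \<in> {..<X}. (1 + x) ^ k \<in> A})"
      using lower_rel_density_roots[OF k A(1,3)] by blast
    have "\<beta> * real N \<le> real (card (sumset s A \<inter> {1..N}))" if "N \<ge> s * (Suc X0) ^ k" for N
      unfolding \<beta>_def
      by (rule sumset_powers_density[OF k s(1) assms(2) s(2)
            order_trans[OF representations_le_moment mom] X0 that])
    moreover have "unconfined (sumset s A)"
      using A(2) s(1) by (intro unconfined_sumset) (simp_all add: unconfined_iff)
    ultimately have "\<forall>\<^sub>F n in sequentially. n \<in> sumset t (sumset s A)" by (rule t(2))
    then show "\<forall>\<^sub>F n in sequentially. n \<in> sumset (t * s) A"
      by eventually_elim (rule sumset_mult)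
  qed
qed

end
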